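(* Let $n\ge2$, let $G$ be a torsion-free nilpotent group of class $n-1$, and let $H\trianglelefteq G$ be an abelian normal subgroup. Then there exists a faithful representation of $G$ over $\mathbb Q$, i.e. a right $\mathbb QG$-module $M$ on which $G$ acts faithfully, such that $M\Delta_G^n=0$ (the representation is $n$-step stable) and $M\Delta_H^2=0$ (its restriction to $H$ is $2$-step stable).
   Context: For a commutative ring $K$ and a group $L$, $\Delta_L$ denotes the augmentation ideal of the group ring $KL$, i.e. the kernel of the map $KL\to K$ sending every element of $L$ to $1$; here $K=\mathbb Q$. A representation $(M,L)$, where $M$ is a right $KL$-module, is $r$-step stable if $M\Delta_L^r=0$; the class of such representations is denoted $\mathfrak S^r$. No finite-dimensionality of $M$ or finite generation of $G$ is assumed. *)

theory Defs
  imports Complex_Main "HOL-Algebra.Ideal_Product" "HOL-Algebra.Generated_Groups"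
begin

section \<open>Torsion-free and nilpotent groups\<close>

definition torsion_free :: "('g, 'b) monoid_scheme \<Rightarrow> bool" where
  "torsion_free G \<longleftrightarrow>
     (\<forall>x\<in>carrier G. \<forall>k::nat. 0 < k \<longrightarrow> x [^]\<^bsub>G\<^esub> k = \<one>\<^bsub>G\<^esub> \<longrightarrow> x = \<one>\<^bsub>G\<^esub>)"

definition commutator_subgroup :: "('g, 'b) monoid_scheme \<Rightarrow> 'g set \<Rightarrow> 'g set \<Rightarrow> 'g set" where
  "commutator_subgroup G A B =
     generate G {x \<otimes>\<^bsub>G\<^esub> y \<otimes>\<^bsub>G\<^esub> inv\<^bsub>G\<^esub> x \<otimes>\<^bsub>G\<^esub> inv\<^bsub>G\<^esub> y | x y. x \<in> A \<and> y \<in> B}"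

text \<open>The indexing starts at 0: \<open>lower_central G i\<close> is the term usually written
  \<open>\<gamma>\<close> with index \<open>i + 1\<close>. Hence the class of a nilpotent group is the least \<open>c\<close> for which
  \<open>lower_central G c\<close> is trivial (0 exactly for the trivial group).\<close>

primrec lower_central :: "('g, 'b) monoid_scheme \<Rightarrow> nat \<Rightarrow> 'g set" where
  "lower_central G 0 = carrier G"
| "lower_central G (Suc i) = commutator_subgroup G (lower_central G i) (carrier G)"

definition nilpotent :: "('g, 'b) monoid_scheme \<Rightarrow> bool" where
  "nilpotent G \<longleftrightarrow> (\<exists>c. lower_central G c = {\<one>\<^bsub>G\<^esub>})"

definition nilpotency_class :: "('g, 'b) monoid_scheme \<Rightarrow> nat" where
  "nilpotency_class G = (LEAST c. lower_central G c = {\<one>\<^bsub>G\<^esub>})"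


section \<open>Group rings\<close>

text \<open>The coefficient ring \<open>K\<close> is the type \<open>'k\<close>. Elements of \<open>KG\<close> are the finitely supported
  functions that vanish off \<open>carrier G\<close>; so for a subgroup \<open>H\<close> the ring \<open>KH\<close> is literally a
  subset of \<open>KG\<close>.\<close>

definition supp :: "('g \<Rightarrow> 'k::zero) \<Rightarrow> 'g set" where
  "supp a = {x. a x \<noteq> 0}"

definition group_elt :: "'g \<Rightarrow> 'g \<Rightarrow> 'k::comm_ring_1" where
  "group_elt g = (\<lambda>x. if x = g then 1 else 0)"

definition group_ring :: "('g, 'b) monoid_scheme \<Rightarrow> ('g \<Rightarrow> 'k::comm_ring_1) ring" where
  "group_ring G = \<lparr>
     carrier = {a. finite (supp a) \<and> supp a \<subseteq> carrier G},
     mult = (\<lambda>a b g. \<Sum>(x, y)\<in>{(x, y). x \<in> supp a \<and> y \<in> supp b \<and> x \<otimes>\<^bsub>G\<^esub> y = g}. a x * b y),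
     one = group_elt \<one>\<^bsub>G\<^esub>,
     zero = (\<lambda>g. 0),
     add = (\<lambda>a b g. a g + b g) \<rparr>"

definition augmentation :: "('g \<Rightarrow> 'k::comm_ring_1) \<Rightarrow> 'k" where
  "augmentation a = (\<Sum>x\<in>supp a. a x)"

definition augmentation_ideal ::
    "('g, 'b) monoid_scheme \<Rightarrow> ('g \<Rightarrow> 'k::comm_ring_1) set" where
  "augmentation_ideal G = {a \<in> carrier (group_ring G). augmentation a = 0}"

primrec ideal_power :: "('a, 'b) ring_scheme \<Rightarrow> 'a set \<Rightarrow> nat \<Rightarrow> 'a set" where
  "ideal_power R I 0 = carrier R"
| "ideal_power R I (Suc r) = ideal_prod R (ideal_power R I r) I"


section \<open>Right modules and representations\<close>

text \<open>Unital right modules over a not necessarily commutative ring. As for the library's record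
  of (left) modules, the additive structure of \<open>M\<close> is that of a ring record whose fields
  \<open>mult\<close> and \<open>one\<close> are irrelevant.\<close>

record ('a, 'm) right_module = "'m ring" +
  ract :: "'m \<Rightarrow> 'a \<Rightarrow> 'm" (infixl \<open>\<triangleleft>\<index>\<close> 70)

locale right_module = R?: ring R + M?: abelian_group M for R (structure) and M (structure) +
  assumes ract_closed:
      "\<lbrakk>x \<in> carrier M; a \<in> carrier R\<rbrakk> \<Longrightarrow> x \<triangleleft>\<^bsub>M\<^esub> a \<in> carrier M"
    and ract_add_left:
      "\<lbrakk>x \<in> carrier M; y \<in> carrier M; a \<in> carrier R\<rbrakk>
        \<Longrightarrow> (x \<oplus>\<^bsub>M\<^esub> y) \<triangleleft>\<^bsub>M\<^esub> a = (x \<triangleleft>\<^bsub>M\<^esub> a) \<oplus>\<^bsub>M\<^esub> (y \<triangleleft>\<^bsub>M\<^esub> a)"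
    and ract_add_right:
      "\<lbrakk>x \<in> carrier M; a \<in> carrier R; b \<in> carrier R\<rbrakk>
        \<Longrightarrow> x \<triangleleft>\<^bsub>M\<^esub> (a \<oplus>\<^bsub>R\<^esub> b) = (x \<triangleleft>\<^bsub>M\<^esub> a) \<oplus>\<^bsub>M\<^esub> (x \<triangleleft>\<^bsub>M\<^esub> b)"
    and ract_mult:
      "\<lbrakk>x \<in> carrier M; a \<in> carrier R; b \<in> carrier R\<rbrakk>
        \<Longrightarrow> x \<triangleleft>\<^bsub>M\<^esub> (a \<otimes>\<^bsub>R\<^esub> b) = (x \<triangleleft>\<^bsub>M\<^esub> a) \<triangleleft>\<^bsub>M\<^esub> b"
    and ract_one:
      "x \<in> carrier M \<Longrightarrow> x \<triangleleft>\<^bsub>M\<^esub> \<one>\<^bsub>R\<^esub> = x"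

definition faithful_rep ::
    "('g, 'b) monoid_scheme \<Rightarrow> ('g \<Rightarrow> 'k::comm_ring_1, 'm, 'c) right_module_scheme \<Rightarrow> bool" where
  "faithful_rep G M \<longleftrightarrow>
     (\<forall>g\<in>carrier G. (\<forall>x\<in>carrier M. x \<triangleleft>\<^bsub>M\<^esub> group_elt g = x) \<longrightarrow> g = \<one>\<^bsub>G\<^esub>)"

definition module_times :: "('a, 'm, 'c) right_module_scheme \<Rightarrow> 'a set \<Rightarrow> 'm set" where
  "module_times M I = generate (add_monoid M) {x \<triangleleft>\<^bsub>M\<^esub> a | x a. x \<in> carrier M \<and> a \<in> I}"

text \<open>For a subgroup \<open>H\<close> of \<open>G\<close>, the restriction of a \<open>KG\<close>-module to \<open>H\<close> is given by the same
  record \<open>M\<close>, with the group taken to be \<open>G\<lparr>carrier := H\<rparr>\<close> (see \<open>right_module_restrict\<close> below).\<close>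

definition step_stable ::
    "nat \<Rightarrow> ('g, 'b) monoid_scheme \<Rightarrow> ('g \<Rightarrow> 'k::comm_ring_1, 'm, 'c) right_module_scheme \<Rightarrow> bool"
  where
  "step_stable r L M \<longleftrightarrow>
     module_times M (ideal_power (group_ring L) (augmentation_ideal L) r) = {\<zero>\<^bsub>M\<^esub>}"


section \<open>Consistency of the definitions\<close>

lemma group_ring_carrier_iff:
  "a \<in> carrier (group_ring G) \<longleftrightarrow> finite (supp a) \<and> supp a \<subseteq> carrier G"
  by (simp add: group_ring_def)

lemma group_ring_mult_apply:
  fixes a b :: "'g \<Rightarrow> 'k::comm_ring_1"
  assumes "finite S" "finite T" "supp a \<subseteq> S" "supp b \<subseteq> T"
  shows "(a \<otimes>\<^bsub>group_ring G\<^esub> b) g = (\<Sum>x\<in>S. \<Sum>y\<in>T. if x \<otimes>\<^bsub>G\<^esub> y = g then a x * b y else 0)"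
proof -
  have "(a \<otimes>\<^bsub>group_ring G\<^esub> b) g
      = (\<Sum>p\<in>{(x, y). x \<in> supp a \<and> y \<in> supp b \<and> x \<otimes>\<^bsub>G\<^esub> y = g}. a (fst p) * b (snd p))"
    by (simp add: group_ring_def case_prod_unfold)
  also have "\<dots> = (\<Sum>p\<in>S \<times> T. if fst p \<otimes>\<^bsub>G\<^esub> snd p = g then a (fst p) * b (snd p) else 0)"
    using assms by (intro sum.mono_neutral_cong_left) (auto simp: supp_def)
  also have "\<dots> = (\<Sum>x\<in>S. \<Sum>y\<in>T. if x \<otimes>\<^bsub>G\<^esub> y = g then a x * b y else 0)"
    by (simp add: sum.cartesian_product case_prod_unfold)
  finally show ?thesis .
qed

lemma group_ring_mult_supp:
  "supp (a \<otimes>\<^bsub>group_ring G\<^esub> b) \<subseteq> (\<lambda>(x, y). x \<otimes>\<^bsub>G\<^esub> y) ` (supp a \<times> supp b)"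
proof
  fix g assume "g \<in> supp (a \<otimes>\<^bsub>group_ring G\<^esub> b)"
  then have "(\<Sum>(x, y)\<in>{(x, y). x \<in> supp a \<and> y \<in> supp b \<and> x \<otimes>\<^bsub>G\<^esub> y = g}. a x * b y) \<noteq> 0"
    by (simp add: supp_def group_ring_def)
  then have "{(x, y). x \<in> supp a \<and> y \<in> supp b \<and> x \<otimes>\<^bsub>G\<^esub> y = g} \<noteq> {}"
    by (rule contrapos_nn) (simp only: sum.empty)
  then show "g \<in> (\<lambda>(x, y). x \<otimes>\<^bsub>G\<^esub> y) ` (supp a \<times> supp b)" by auto
qed

lemma group_ring_mult_closed:
  assumes "group G" "a \<in> carrier (group_ring G)" "b \<in> carrier (group_ring G)"
  shows "a \<otimes>\<^bsub>group_ring G\<^esub> b \<in> carrier (group_ring G)"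
proof -
  interpret group G by fact
  have "finite ((\<lambda>(x, y). x \<otimes>\<^bsub>G\<^esub> y) ` (supp a \<times> supp b))"
    using assms by (simp add: group_ring_carrier_iff)
  moreover have "(\<lambda>(x, y). x \<otimes>\<^bsub>G\<^esub> y) ` (supp a \<times> supp b) \<subseteq> carrier G"
    using assms by (auto simp: group_ring_carrier_iff)
  ultimately show ?thesis
    using group_ring_mult_supp[of G a b] finite_subset
    unfolding group_ring_carrier_iff by (metis subset_trans)
qed

lemma group_ring_add_closed:
  assumes "a \<in> carrier (group_ring G)" "b \<in> carrier (group_ring G)"
  shows "a \<oplus>\<^bsub>group_ring G\<^esub> b \<in> carrier (group_ring G)"
proof -
  have "supp (a \<oplus>\<^bsub>group_ring G\<^esub> b) \<subseteq> supp a \<union> supp b"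
    by (auto simp: supp_def group_ring_def)
  moreover have "finite (supp a \<union> supp b)" "supp a \<union> supp b \<subseteq> carrier G"
    using assms by (simp_all add: group_ring_carrier_iff)
  ultimately show ?thesis
    unfolding group_ring_carrier_iff by (blast intro: finite_subset)
qed

lemma group_ring_mult_assoc:
  fixes a b c :: "'g \<Rightarrow> 'k::comm_ring_1"
  assumes "group G" and a: "a \<in> carrier (group_ring G)" and b: "b \<in> carrier (group_ring G)"
    and c: "c \<in> carrier (group_ring G)"
  shows "(a \<otimes>\<^bsub>group_ring G\<^esub> b) \<otimes>\<^bsub>group_ring G\<^esub> c = a \<otimes>\<^bsub>group_ring G\<^esub> (b \<otimes>\<^bsub>group_ring G\<^esub> c)"
proof
  interpret group G by fact
  fix g
  let ?A = "supp a" and ?B = "supp b" and ?C = "supp c"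
  let ?AB = "(\<lambda>(x, y). x \<otimes>\<^bsub>G\<^esub> y) ` (?A \<times> ?B)" and ?BC = "(\<lambda>(x, y). x \<otimes>\<^bsub>G\<^esub> y) ` (?B \<times> ?C)"
  have fin: "finite ?A" "finite ?B" "finite ?C"
    using a b c by (auto simp: group_ring_carrier_iff)
  then have fin2: "finite ?AB" "finite ?BC" by auto
  have mem: "\<And>x. x \<in> ?A \<Longrightarrow> x \<in> carrier G" "\<And>x. x \<in> ?B \<Longrightarrow> x \<in> carrier G"
      "\<And>x. x \<in> ?C \<Longrightarrow> x \<in> carrier G"
    using a b c by (auto simp: group_ring_carrier_iff)
  have "((a \<otimes>\<^bsub>group_ring G\<^esub> b) \<otimes>\<^bsub>group_ring G\<^esub> c) g
      = (\<Sum>w\<in>?AB. \<Sum>z\<in>?C. if w \<otimes>\<^bsub>G\<^esub> z = g then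
          (\<Sum>x\<in>?A. \<Sum>y\<in>?B. if x \<otimes>\<^bsub>G\<^esub> y = w then a x * b y else 0) * c z else 0)"
    using group_ring_mult_apply[OF fin2(1) fin(3) group_ring_mult_supp order_refl, of G g]
    by (simp add: group_ring_mult_apply[OF fin(1,2) order_refl order_refl] cong: if_cong)
  also have "\<dots> = (\<Sum>w\<in>?AB. \<Sum>z\<in>?C. \<Sum>x\<in>?A. \<Sum>y\<in>?B.
      if x \<otimes>\<^bsub>G\<^esub> y = w then (if x \<otimes>\<^bsub>G\<^esub> y \<otimes>\<^bsub>G\<^esub> z = g then a x * b y * c z else 0) else 0)"
    by (rule sum.cong[OF refl], rule sum.cong[OF refl])
      (auto simp: sum_distrib_right intro!: sum.cong sum.neutral)
  also have "\<dots> = (\<Sum>z\<in>?C. \<Sum>x\<in>?A. \<Sum>y\<in>?B. \<Sum>w\<in>?AB.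
      if x \<otimes>\<^bsub>G\<^esub> y = w then (if x \<otimes>\<^bsub>G\<^esub> y \<otimes>\<^bsub>G\<^esub> z = g then a x * b y * c z else 0) else 0)"
    by (rule trans[OF sum.swap], rule sum.cong[OF refl], rule trans[OF sum.swap],
        rule sum.cong[OF refl], rule sum.swap)
  also have "\<dots> = (\<Sum>z\<in>?C. \<Sum>x\<in>?A. \<Sum>y\<in>?B.
      if x \<otimes>\<^bsub>G\<^esub> y \<otimes>\<^bsub>G\<^esub> z = g then a x * b y * c z else 0)"
  proof (rule sum.cong[OF refl], rule sum.cong[OF refl], rule sum.cong[OF refl])
    fix z x y assume "z \<in> ?C" "x \<in> ?A" "y \<in> ?B"
    then have "x \<otimes>\<^bsub>G\<^esub> y \<in> ?AB" by auto
    then show "(\<Sum>w\<in>?AB. if x \<otimes>\<^bsub>G\<^esub> y = w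
          then (if x \<otimes>\<^bsub>G\<^esub> y \<otimes>\<^bsub>G\<^esub> z = g then a x * b y * c z else 0) else 0)
        = (if x \<otimes>\<^bsub>G\<^esub> y \<otimes>\<^bsub>G\<^esub> z = g then a x * b y * c z else 0)"
      by (simp add: sum.delta'[OF fin2(1)])
  qed
  also have "\<dots> = (\<Sum>x\<in>?A. \<Sum>y\<in>?B. \<Sum>z\<in>?C.
      if x \<otimes>\<^bsub>G\<^esub> y \<otimes>\<^bsub>G\<^esub> z = g then a x * b y * c z else 0)"
    by (rule trans[OF sum.swap], rule sum.cong[OF refl], rule sum.swap)
  also have "\<dots> = (\<Sum>x\<in>?A. \<Sum>y\<in>?B. \<Sum>z\<in>?C. \<Sum>w\<in>?BC.
      if y \<otimes>\<^bsub>G\<^esub> z = w then (if x \<otimes>\<^bsub>G\<^esub> (y \<otimes>\<^bsub>G\<^esub> z) = g then a x * (b y * c z) else 0) else 0)"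
  proof (rule sum.cong[OF refl], rule sum.cong[OF refl], rule sum.cong[OF refl])
    fix x y z assume xyz: "x \<in> ?A" "y \<in> ?B" "z \<in> ?C"
    then have "y \<otimes>\<^bsub>G\<^esub> z \<in> ?BC" by auto
    moreover have "x \<otimes>\<^bsub>G\<^esub> y \<otimes>\<^bsub>G\<^esub> z = x \<otimes>\<^bsub>G\<^esub> (y \<otimes>\<^bsub>G\<^esub> z)"
      using xyz by (simp add: m_assoc mem)
    ultimately show "(if x \<otimes>\<^bsub>G\<^esub> y \<otimes>\<^bsub>G\<^esub> z = g then a x * b y * c z else 0)
        = (\<Sum>w\<in>?BC. if y \<otimes>\<^bsub>G\<^esub> z = w
            then (if x \<otimes>\<^bsub>G\<^esub> (y \<otimes>\<^bsub>G\<^esub> z) = g then a x * (b y * c z) else 0) else 0)"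
      by (simp add: mult.assoc sum.delta'[OF fin2(2)])
  qed
  also have "\<dots> = (\<Sum>x\<in>?A. \<Sum>w\<in>?BC. \<Sum>y\<in>?B. \<Sum>z\<in>?C.
      if y \<otimes>\<^bsub>G\<^esub> z = w then (if x \<otimes>\<^bsub>G\<^esub> (y \<otimes>\<^bsub>G\<^esub> z) = g then a x * (b y * c z) else 0) else 0)"
    by (rule sum.cong[OF refl], rule sym, rule trans[OF sum.swap], rule sum.cong[OF refl],
        rule sum.swap)
  also have "\<dots> = (\<Sum>x\<in>?A. \<Sum>w\<in>?BC. if x \<otimes>\<^bsub>G\<^esub> w = g then
      a x * (\<Sum>y\<in>?B. \<Sum>z\<in>?C. if y \<otimes>\<^bsub>G\<^esub> z = w then b y * c z else 0) else 0)"
    by (rule sum.cong[OF refl], rule sum.cong[OF refl])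
      (auto simp: sum_distrib_left intro!: sum.cong sum.neutral)
  also have "\<dots> = (a \<otimes>\<^bsub>group_ring G\<^esub> (b \<otimes>\<^bsub>group_ring G\<^esub> c)) g"
    using group_ring_mult_apply[OF fin(1) fin2(2) order_refl group_ring_mult_supp, of G g]
    by (simp add: group_ring_mult_apply[OF fin(2,3) order_refl order_refl] cong: if_cong)
  finally show "((a \<otimes>\<^bsub>group_ring G\<^esub> b) \<otimes>\<^bsub>group_ring G\<^esub> c) g
      = (a \<otimes>\<^bsub>group_ring G\<^esub> (b \<otimes>\<^bsub>group_ring G\<^esub> c)) g" .
qed

lemma supp_group_elt: "supp (group_elt g :: 'g \<Rightarrow> 'k::comm_ring_1) = {g}"
  by (auto simp: supp_def group_elt_def)

lemma group_elt_apply: "group_elt g x = (if x = g then 1 else 0)"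
  by (simp add: group_elt_def)

lemma group_elt_closed:
  "g \<in> carrier G \<Longrightarrow> (group_elt g :: 'g \<Rightarrow> 'k::comm_ring_1) \<in> carrier (group_ring G)"
  by (simp add: group_ring_carrier_iff supp_group_elt)

lemma group_elt_mult:
  "(group_elt g \<otimes>\<^bsub>group_ring G\<^esub> group_elt h :: 'g \<Rightarrow> 'k::comm_ring_1) = group_elt (g \<otimes>\<^bsub>G\<^esub> h)"
  by (rule ext, subst group_ring_mult_apply[of "{g}" "{h}"])
    (auto simp: supp_group_elt group_elt_apply)

lemma group_ring_ring:
  assumes "group G"
  shows "ring (group_ring G :: ('g \<Rightarrow> 'k::comm_ring_1) ring)"
proof -
  interpret group G by fact
  let ?R = "group_ring G :: ('g \<Rightarrow> 'k) ring"
  have add: "(a \<oplus>\<^bsub>?R\<^esub> b) g = a g + b g" and zero: "\<zero>\<^bsub>?R\<^esub> = (\<lambda>g. 0)"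
    and one: "\<one>\<^bsub>?R\<^esub> = group_elt \<one>\<^bsub>G\<^esub>" for a b g
    by (simp_all add: group_ring_def)
  have sadd: "supp (a \<oplus>\<^bsub>?R\<^esub> b) \<subseteq> supp a \<union> supp b" for a b :: "'g \<Rightarrow> 'k"
    by (auto simp: supp_def add)
  show ?thesis
  proof (rule ringI)
    show "abelian_group ?R"
    proof (rule abelian_groupI)
      fix a assume "a \<in> carrier ?R"
      moreover have "supp (\<lambda>g. - a g) = supp a" by (simp add: supp_def)
      ultimately show "\<exists>b\<in>carrier ?R. b \<oplus>\<^bsub>?R\<^esub> a = \<zero>\<^bsub>?R\<^esub>"
        by (intro bexI[of _ "\<lambda>g. - a g"]) (auto simp: group_ring_carrier_iff fun_eq_iff add zero)
    qed (auto simp: group_ring_add_closed fun_eq_iff add zero algebra_simps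
        group_ring_carrier_iff[where a = "\<lambda>g. 0"] supp_def)
    show "monoid ?R"
    proof (rule monoidI)
      show "\<one>\<^bsub>?R\<^esub> \<in> carrier ?R" by (simp add: one group_elt_closed)
      fix a assume a: "a \<in> carrier ?R"
      then have fin: "finite (supp a)" and mem: "\<And>x. x \<in> supp a \<Longrightarrow> x \<in> carrier G"
        by (auto simp: group_ring_carrier_iff)
      have *: "(\<Sum>x\<in>supp a. if x = g then a x else 0) = a g" for g
        using fin by (auto simp: supp_def)
      show "\<one>\<^bsub>?R\<^esub> \<otimes>\<^bsub>?R\<^esub> a = a"
      proof
        fix g
        have "(\<one>\<^bsub>?R\<^esub> \<otimes>\<^bsub>?R\<^esub> a) g = (\<Sum>x\<in>supp a. if x = g then a x else 0)"
          using fin by (subst group_ring_mult_apply[of "{\<one>\<^bsub>G\<^esub>}" "supp a"])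
            (auto simp: one supp_group_elt group_elt_apply mem intro!: sum.cong)
        then show "(\<one>\<^bsub>?R\<^esub> \<otimes>\<^bsub>?R\<^esub> a) g = a g" by (simp only: *)
      qed
      show "a \<otimes>\<^bsub>?R\<^esub> \<one>\<^bsub>?R\<^esub> = a"
      proof
        fix g
        have "(a \<otimes>\<^bsub>?R\<^esub> \<one>\<^bsub>?R\<^esub>) g = (\<Sum>x\<in>supp a. if x = g then a x else 0)"
          using fin by (subst group_ring_mult_apply[of "supp a" "{\<one>\<^bsub>G\<^esub>}"])
            (auto simp: one supp_group_elt group_elt_apply mem intro!: sum.cong)
        then show "(a \<otimes>\<^bsub>?R\<^esub> \<one>\<^bsub>?R\<^esub>) g = a g" by (simp only: *)
      qed
    qed (simp_all add: assms group_ring_mult_closed group_ring_mult_assoc)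
  next
    fix a b c :: "'g \<Rightarrow> 'k"
    assume "a \<in> carrier ?R" "b \<in> carrier ?R" "c \<in> carrier ?R"
    then have fin: "finite (supp a)" "finite (supp b)" "finite (supp c)"
      by (auto simp: group_ring_carrier_iff)
    let ?U = "supp a \<union> supp b"
    have U: "finite ?U" using fin by simp
    have R: "(d \<otimes>\<^bsub>?R\<^esub> c) g = (\<Sum>x\<in>?U. \<Sum>y\<in>supp c. if x \<otimes>\<^bsub>G\<^esub> y = g then d x * c y else 0)"
      and L: "(c \<otimes>\<^bsub>?R\<^esub> d) g = (\<Sum>x\<in>supp c. \<Sum>y\<in>?U. if x \<otimes>\<^bsub>G\<^esub> y = g then c x * d y else 0)"
      if "supp d \<subseteq> ?U" for d g
      using that fin U by (auto intro!: group_ring_mult_apply)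
    show "(a \<oplus>\<^bsub>?R\<^esub> b) \<otimes>\<^bsub>?R\<^esub> c = a \<otimes>\<^bsub>?R\<^esub> c \<oplus>\<^bsub>?R\<^esub> b \<otimes>\<^bsub>?R\<^esub> c"
      by (auto simp: fun_eq_iff add R[OF sadd] R[OF Un_upper1] R[OF Un_upper2]
          sum.distrib[symmetric] algebra_simps intro!: sum.cong)
    show "c \<otimes>\<^bsub>?R\<^esub> (a \<oplus>\<^bsub>?R\<^esub> b) = c \<otimes>\<^bsub>?R\<^esub> a \<oplus>\<^bsub>?R\<^esub> c \<otimes>\<^bsub>?R\<^esub> b"
      by (auto simp: fun_eq_iff add L[OF sadd] L[OF Un_upper1] L[OF Un_upper2]
          sum.distrib[symmetric] algebra_simps intro!: sum.cong)
  qed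
qed

lemma right_module_restrict:
  fixes M :: "('g \<Rightarrow> 'k::comm_ring_1, 'm, 'c) right_module_scheme"
  assumes "group G" "subgroup H G" "right_module (group_ring G) M"
  shows "right_module (group_ring (G\<lparr>carrier := H\<rparr>)) M"
proof -
  interpret RM: right_module "group_ring G" M by fact
  have "group (G\<lparr>carrier := H\<rparr>)"
    using assms(1,2) by (simp add: subgroup.subgroup_is_group)
  then have "ring (group_ring (G\<lparr>carrier := H\<rparr>) :: ('g \<Rightarrow> 'k) ring)"
    by (rule group_ring_ring)
  moreover have "a \<in> carrier (group_ring G)"
    if "a \<in> carrier (group_ring (G\<lparr>carrier := H\<rparr>))" for a :: "'g \<Rightarrow> 'k"
    using that subgroup.subset[OF assms(2)] by (auto simp: group_ring_carrier_iff)
  moreover have "mult (group_ring (G\<lparr>carrier := H\<rparr>) :: ('g \<Rightarrow> 'k) ring) = mult (group_ring G)"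
    "add (group_ring (G\<lparr>carrier := H\<rparr>) :: ('g \<Rightarrow> 'k) ring) = add (group_ring G)"
    "one (group_ring (G\<lparr>carrier := H\<rparr>) :: ('g \<Rightarrow> 'k) ring) = one (group_ring G)"
    by (simp_all add: group_ring_def)
  ultimately show ?thesis
    by (intro right_module.intro right_module_axioms.intro RM.M.abelian_group_axioms)
      (simp_all add: RM.ract_closed RM.ract_add_left RM.ract_add_right RM.ract_mult RM.ract_one)
qed

end

(*
  Weight the elements of the i-th term of the lower central series by i, and call a function from a
  subgroup K to Q polynomial of degree < n if all its iterated differences of total weight at
  least n vanish. Let P(K) be the space of such functions f which are moreover affine along H:
  f(hh'x) - f(hx) - f(h'x) + f(x) = 0. The module is P(G), on which G acts by translation; it is
  killed by the n-th power of the augmentation ideal of G and by the square of that of H.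

  For faithfulness, the kernel of the action is normal, so if it is nontrivial it contains a central
  z different from 1. The subgroup K = H Z(G) is abelian, hence has a homomorphism l to Q with
  l(z) different from 0, and l is in P(K). It remains to extend functions from P(K) to P(G). By
  Zorn's lemma and the normalizer condition it suffices to pass from K to K<t> with t normalizing K.
  If t has infinite order modulo K and has the greatest possible weight, then f(t^a x) = f(x) works.
  If t^m = u is in K, then b |-> f(u^b x) is a polynomial in the integer b, and
  f(t^a x) is its value at the rational number b = a/m.
*)
theory Submission
  imports Defs "HOL-Computational_Algebra.Formal_Power_Series"
begin

section \<open>Commutators and the lower central series\<close>

text \<open>Since n exceeds the class by exactly one, an extension must not raise the degree:
  translation by an element of \<open>F w\<close> has to lower it by the full weight
  \<open>w + 1\<close>. The weights on a subgroup K are those of G, and the obstacle is that a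
  product of some y in K with a power of t may lie deeper in the series than either factor. For
  infinite order this is excluded by the maximal weight of t. For finite order it cannot be
  excluded; but the m-th power of the product lies in K and in the same \<open>F w\<close>, and for
  the operator \<rho> that represents translation by the product, the m-th power of \<rho> minus 1
  is m(\<rho> - 1) up to the square of \<rho> - 1. Dividing by m gives \<rho> - 1 the full drop. So
  characteristic 0 serves twice, here and in the binomial series that gives the value at a/m. The
  homomorphism l comes from the same extension theorem, applied to the abelian group H Z(G) with a
  filtration of length one. That H is abelian enters in making H Z(G) abelian.\<close>

context group
begin

lemma inv_mult_cancel:
  assumes "x \<in> carrier G" "y \<in> carrier G"
  shows "x \<otimes> (inv x \<otimes> y) = y" "inv x \<otimes> (x \<otimes> y) = y"
  using assms by (simp_all add: m_assoc[symmetric])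

lemmas word_simps = m_assoc inv_mult_group inv_mult_cancel

definition commutator :: "'a \<Rightarrow> 'a \<Rightarrow> 'a" where
  "commutator x y = x \<otimes> y \<otimes> inv x \<otimes> inv y"

lemma commutator_closed [simp]:
  "\<lbrakk>x \<in> carrier G; y \<in> carrier G\<rbrakk> \<Longrightarrow> commutator x y \<in> carrier G"
  by (simp add: commutator_def)

lemma inv_commutator:
  "\<lbrakk>x \<in> carrier G; y \<in> carrier G\<rbrakk> \<Longrightarrow> inv (commutator x y) = commutator y x"
  by (simp add: commutator_def word_simps)

lemma conj_eq_commutator:
  "\<lbrakk>h \<in> carrier G; x \<in> carrier G\<rbrakk> \<Longrightarrow> inv (commutator h x) \<otimes> h = x \<otimes> h \<otimes> inv x"
  by (simp add: commutator_def word_simps)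

text \<open>Each factor is a quotient of two words, and its denominator is the numerator of the next
  factor in cyclic order, so the product telescopes.\<close>

lemma hall_witt:
  assumes c: "x \<in> carrier G" "y \<in> carrier G" "z \<in> carrier G"
  shows "(x \<otimes> commutator y (commutator (inv x) z) \<otimes> inv x) \<otimes>
         (z \<otimes> commutator x (commutator (inv z) y) \<otimes> inv z) \<otimes>
         (y \<otimes> commutator z (commutator (inv y) x) \<otimes> inv y) = \<one>"
proof -
  have conj_eq: "a \<otimes> commutator b (commutator (inv a) d) \<otimes> inv a
      = (a \<otimes> b \<otimes> inv a \<otimes> d \<otimes> a) \<otimes> inv (d \<otimes> a \<otimes> inv d \<otimes> b \<otimes> d)"
    if "a \<in> carrier G" "b \<in> carrier G" "d \<in> carrier G" for a b d
    using that by (simp add: commutator_def word_simps)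
  have "(u \<otimes> inv v) \<otimes> (v \<otimes> inv w) \<otimes> (w \<otimes> inv u) = \<one>"
    if "u \<in> carrier G" "v \<in> carrier G" "w \<in> carrier G" for u v w
    using that by (simp add: word_simps)
  from this[of "x \<otimes> y \<otimes> inv x \<otimes> z \<otimes> x" "z \<otimes> x \<otimes> inv z \<otimes> y \<otimes> z" "y \<otimes> z \<otimes> inv y \<otimes> x \<otimes> y"]
  show ?thesis using c by (simp only: conj_eq m_closed inv_closed)
qed

lemma normal_conj:
  assumes "N \<lhd> G" "x \<in> carrier G" "a \<in> N"
  shows "x \<otimes> a \<otimes> inv x \<in> N" "inv x \<otimes> a \<otimes> x \<in> N"
  using assms normal.inv_op_closed1 normal.inv_op_closed2 by metis+

text \<open>In the Hall-Witt identity for \<open>x\<close>, \<open>g\<close>, \<open>inv a\<close>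
  two factors lie in \<open>N\<close>, hence so does the third, a conjugate of the wanted
  commutator.\<close>

lemma three_subgroups_element:
  assumes N: "N \<lhd> G" and c: "x \<in> carrier G" "a \<in> carrier G" "g \<in> carrier G"
    and "commutator g (commutator (inv x) (inv a)) \<in> N"
    and "commutator (inv a) (commutator (inv g) x) \<in> N"
  shows "commutator x (commutator a g) \<in> N"
proof -
  interpret N: normal N G by fact
  define p where "p = x \<otimes> commutator g (commutator (inv x) (inv a)) \<otimes> inv x"
  define q where "q = commutator x (commutator a g)"
  define r where "r = g \<otimes> commutator (inv a) (commutator (inv g) x) \<otimes> inv g"
  have pr: "p \<in> N" "r \<in> N" using assms by (auto simp: p_def r_def intro: normal_conj)
  have cl: "p \<in> carrier G" "q \<in> carrier G" "r \<in> carrier G"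
    using c by (simp_all add: p_def q_def r_def)
  have "p \<otimes> (inv a \<otimes> q \<otimes> a) \<otimes> r = \<one>"
    using hall_witt[of x g "inv a"] c unfolding p_def q_def r_def by simp
  then have "a \<otimes> inv p \<otimes> (p \<otimes> (inv a \<otimes> q \<otimes> a) \<otimes> r) \<otimes> inv r \<otimes> inv a = a \<otimes> inv p \<otimes> \<one> \<otimes> inv r \<otimes> inv a"
    by simp
  then have "q = a \<otimes> (inv p \<otimes> inv r) \<otimes> inv a"
    using cl c by (simp add: word_simps)
  moreover have "inv p \<otimes> inv r \<in> N" using pr by (intro N.m_closed N.m_inv_closed)
  ultimately show ?thesis using normal_conj[OF N c(2)] by (simp add: q_def)
qed

text \<open>Modulo \<open>N\<close>, the elements commuting with \<open>x\<close> form a subgroup,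
  so it is enough to look at generators.\<close>

lemma commutator_in_normal_subgroup:
  assumes N: "N \<lhd> G" and X: "X \<subseteq> carrier G" and S: "S \<subseteq> carrier G"
    and comm: "\<And>x s. x \<in> X \<Longrightarrow> s \<in> S \<Longrightarrow> commutator x s \<in> N"
    and "x \<in> X" "y \<in> generate G S"
  shows "commutator x y \<in> N"
proof -
  interpret N: normal N G by fact
  have xc: "x \<in> carrier G" using assms by auto
  have "y \<in> carrier G \<and> commutator x y \<in> N"
    using assms(6)
  proof induction
    case one
    then show ?case using xc by (simp add: commutator_def)
  next
    case (incl h)
    then show ?case using S comm assms(5) by auto
  next
    case (inv h)
    then have h: "h \<in> carrier G" "commutator x h \<in> N" using S comm assms(5) by auto
    have "commutator x (inv h) = inv h \<otimes> inv (commutator x h) \<otimes> h"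
      using xc h by (simp add: commutator_def word_simps)
    then show ?case using h normal_conj[OF N] by auto
  next
    case (eng h1 h2)
    have "commutator x (h1 \<otimes> h2) = commutator x h1 \<otimes> (h1 \<otimes> commutator x h2 \<otimes> inv h1)"
      using xc eng by (simp add: commutator_def word_simps)
    then show ?case using eng normal_conj[OF N] by auto
  qed
  then show ?thesis ..
qed

lemma lower_central_normal: "lower_central G i \<lhd> G"
  and lower_central_Suc_subset: "lower_central G (Suc i) \<subseteq> lower_central G i"
proof -
  have step: "lower_central G (Suc i) \<lhd> G \<and> lower_central G (Suc i) \<subseteq> lower_central G i"
    if N: "lower_central G i \<lhd> G" for i
  proof -
    interpret N: normal "lower_central G i" G by fact
    let ?S = "{x \<otimes> y \<otimes> inv x \<otimes> inv y |x y. x \<in> lower_central G i \<and> y \<in> carrier G}"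
    have sub: "?S \<subseteq> lower_central G i"
    proof
      fix s assume "s \<in> ?S"
      then obtain x y where xy: "x \<in> lower_central G i" "y \<in> carrier G" "s = x \<otimes> y \<otimes> inv x \<otimes> inv y"
        by blast
      then have "s = x \<otimes> (y \<otimes> inv x \<otimes> inv y)" by (simp add: m_assoc)
      then show "s \<in> lower_central G i" using xy normal_conj[OF N] by auto
    qed
    have eq: "lower_central G (Suc i) = generate G ?S" by (simp add: commutator_subgroup_def)
    have le: "generate G ?S \<subseteq> lower_central G i"
      using sub N.subgroup_axioms by (rule generate_subgroup_incl)
    have sg: "subgroup (generate G ?S) G" using sub by (intro generate_is_subgroup) auto
    interpret S: subgroup "generate G ?S" G by fact
    have "generate G ?S \<lhd> G"
    proof (rule normal_invI[OF sg])
      fix x h assume x: "x \<in> carrier G" and h: "h \<in> generate G ?S"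
      have hl: "h \<in> lower_central G i" using h le by auto
      have hc: "h \<in> carrier G" using N.subset hl by blast
      \<comment> \<open>Normality comes from this membership: the conjugate of \<open>h\<close> by
        \<open>x\<close> is \<open>inv (commutator h x) \<otimes> h\<close>.\<close>
      have "commutator h x \<in> generate G ?S"
        using hl x by (intro generate.incl) (auto simp: commutator_def)
      then have "inv (commutator h x) \<otimes> h \<in> generate G ?S"
        using h by (intro S.m_closed S.m_inv_closed)
      moreover have "inv (commutator h x) \<otimes> h = x \<otimes> h \<otimes> inv x"
        using hc x by (rule conj_eq_commutator)
      ultimately show "x \<otimes> h \<otimes> inv x \<in> generate G ?S" by simp
    qed
    then show ?thesis using eq le by simp
  qed
  have "lower_central G i \<lhd> G" for i
  proof (induction i)
    case 0
    show ?case using normal_invI[OF subgroup_self] by simp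
  next
    case (Suc i)
    then show ?case using step by blast
  qed
  then show "lower_central G i \<lhd> G" "lower_central G (Suc i) \<subseteq> lower_central G i"
    using step by blast+
qed

text \<open>The next term is generated by commutators of some \<open>a\<close> and \<open>g\<close>,
  and the three subgroups argument calls the induction hypothesis at \<open>i\<close> and at
  \<open>Suc i\<close>, so \<open>i\<close> has to stay free. Index \<open>i\<close> stands for
  weight \<open>i + 1\<close>, which is why adding weights yields
  \<open>Suc (i + j)\<close>.\<close>

lemma lower_central_commutator:
  "\<lbrakk>x \<in> lower_central G i; y \<in> lower_central G j\<rbrakk>
     \<Longrightarrow> commutator x y \<in> lower_central G (Suc (i + j))"
proof (induction j arbitrary: i x y)
  case 0
  then show ?case
    by (auto simp: commutator_subgroup_def commutator_def intro!: generate.incl)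
next
  case (Suc j)
  note cl = subgroup.mem_carrier[OF normal_imp_subgroup[OF lower_central_normal]]
  note ic = subgroup.m_inv_closed[OF normal_imp_subgroup[OF lower_central_normal]]
  let ?N = "lower_central G (Suc (i + Suc j))"
  have flip: "commutator v u \<in> lower_central G k"
    if "commutator u v \<in> lower_central G k" "u \<in> carrier G" "v \<in> carrier G" for u v k
    using ic[OF that(1)] that by (simp add: inv_commutator)
  have with_G: "commutator u v \<in> lower_central G (Suc k)"
    if "u \<in> lower_central G k" "v \<in> carrier G" for u v k
    using that by (auto simp: commutator_subgroup_def commutator_def intro!: generate.incl)
  show ?case
  proof (rule commutator_in_normal_subgroup[OF lower_central_normal _ _ _ Suc.prems(1)])
    show "y \<in> generate G {commutator a g |a g. a \<in> lower_central G j \<and> g \<in> carrier G}"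
      using Suc.prems(2) by (simp add: commutator_subgroup_def commutator_def)
    fix x s assume x: "x \<in> lower_central G i"
      and "s \<in> {commutator a g |a g. a \<in> lower_central G j \<and> g \<in> carrier G}"
    then obtain a g where s: "s = commutator a g" "a \<in> lower_central G j" "g \<in> carrier G" by blast
    have c: "x \<in> carrier G" "a \<in> carrier G" using cl x s(2) by blast+
    have "commutator (inv x) (inv a) \<in> lower_central G (Suc (i + j))"
      using x s by (intro Suc.IH ic)
    from with_G[OF this s(3)] have 1: "commutator g (commutator (inv x) (inv a)) \<in> ?N"
      using c s(3) by (subst add_Suc_right) (rule flip, simp_all only: commutator_closed inv_closed)
    have "commutator (inv g) x \<in> lower_central G (Suc i)"
      using with_G[OF x inv_closed[OF s(3)]] c(1) inv_closed[OF s(3)] by (rule flip)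
    from Suc.IH[OF this ic[OF s(2)]] have 2: "commutator (inv a) (commutator (inv g) x) \<in> ?N"
      using c s(3) by (subst add_Suc_right, subst (asm) add_Suc) (rule flip, simp_all only: commutator_closed inv_closed)
    show "commutator x s \<in> ?N"
      unfolding s(1) by (rule three_subgroups_element[OF lower_central_normal c s(3) 1 2])
  qed (use cl in auto)
qed

end

section \<open>Polynomial functions on a filtered group\<close>

context group
begin

text \<open>The equivalence, instead of one inclusion, keeps this set closed under inverses:
  conjugation may map an infinite \<open>K\<close> properly into itself.\<close>

definition normalizer :: "'a set \<Rightarrow> 'a set" where
  "normalizer K = {t \<in> carrier G. \<forall>x\<in>carrier G. inv t \<otimes> x \<otimes> t \<in> K \<longleftrightarrow> x \<in> K}"

lemma normalizer_conj_iff: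
  "\<lbrakk>t \<in> normalizer K; x \<in> carrier G\<rbrakk> \<Longrightarrow> inv t \<otimes> x \<otimes> t \<in> K \<longleftrightarrow> x \<in> K"
  by (simp add: normalizer_def)

lemma subgroup_normalizer: "subgroup (normalizer K) G"
proof (rule subgroupI)
  show "normalizer K \<subseteq> carrier G" by (auto simp: normalizer_def)
  show "normalizer K \<noteq> {}" by (auto simp: normalizer_def intro!: exI[of _ \<one>])
next
  fix t assume t: "t \<in> normalizer K"
  then have tc: "t \<in> carrier G" by (simp add: normalizer_def)
  have "inv (inv t) \<otimes> x \<otimes> inv t \<in> K \<longleftrightarrow> x \<in> K" if x: "x \<in> carrier G" for x
    using normalizer_conj_iff[OF t, of "t \<otimes> x \<otimes> inv t"] x tc by (simp add: word_simps)
  then show "inv t \<in> normalizer K" using tc by (simp add: normalizer_def)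
next
  fix s t assume st: "s \<in> normalizer K" "t \<in> normalizer K"
  then have c: "s \<in> carrier G" "t \<in> carrier G" by (simp_all add: normalizer_def)
  have "inv (s \<otimes> t) \<otimes> x \<otimes> (s \<otimes> t) \<in> K \<longleftrightarrow> x \<in> K" if x: "x \<in> carrier G" for x
  proof -
    have "inv (s \<otimes> t) \<otimes> x \<otimes> (s \<otimes> t) = inv t \<otimes> (inv s \<otimes> x \<otimes> s) \<otimes> t"
      using c x by (simp add: word_simps)
    then show ?thesis using st c x by (simp add: normalizer_conj_iff)
  qed
  then show "s \<otimes> t \<in> normalizer K" using c by (simp add: normalizer_def)
qed

lemmas normalizer_closed = subgroup.mem_carrier[OF subgroup_normalizer]

lemma normalizer_conj_iff':
  assumes "t \<in> normalizer K" "x \<in> carrier G"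
  shows "t \<otimes> x \<otimes> inv t \<in> K \<longleftrightarrow> x \<in> K"
  using normalizer_conj_iff[OF subgroup.m_inv_closed[OF subgroup_normalizer assms(1)] assms(2)]
    normalizer_closed[OF assms(1)] by simp

lemma conj_conj_inv:
  assumes "t \<in> carrier G" "x \<in> carrier G"
  shows "t \<otimes> (inv t \<otimes> x \<otimes> t) \<otimes> inv t = x"
proof -
  have "t \<otimes> (inv t \<otimes> x \<otimes> t) \<otimes> inv t = (t \<otimes> inv t) \<otimes> x \<otimes> (t \<otimes> inv t)"
    using assms by (simp only: m_assoc inv_closed m_closed)
  then show ?thesis using assms by simp
qed

lemma subgroup_subset_normalizer:
  assumes "subgroup K G"
  shows "K \<subseteq> normalizer K"
proof
  interpret K: subgroup K G by fact
  fix t assume t: "t \<in> K"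
  have "x \<in> K" if "inv t \<otimes> x \<otimes> t \<in> K" "x \<in> carrier G" for x
  proof -
    have "t \<otimes> (inv t \<otimes> x \<otimes> t) \<otimes> inv t \<in> K"
      using K.m_closed[OF K.m_closed[OF t that(1)] K.m_inv_closed[OF t]] .
    then show ?thesis using conj_conj_inv[OF K.mem_carrier[OF t] that(2)] by simp
  qed
  moreover have "inv t \<otimes> x \<otimes> t \<in> K" if "x \<in> K" for x
    using K.m_closed[OF K.m_closed[OF K.m_inv_closed[OF t] that] t] .
  ultimately have "\<forall>x\<in>carrier G. inv t \<otimes> x \<otimes> t \<in> K \<longleftrightarrow> x \<in> K" by blast
  then show "t \<in> normalizer K"
    unfolding normalizer_def using K.mem_carrier[OF t] by blast
qed

text \<open>Degrees are measured with right translations, whereas the module action and affineness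
  along \<open>H\<close> use left multiplication; \<open>conj_translate\<close> links the two
  sides.\<close>

definition right_translate :: "'a \<Rightarrow> ('a \<Rightarrow> 'q) \<Rightarrow> 'a \<Rightarrow> 'q" where
  "right_translate g f = (\<lambda>x. f (x \<otimes> g))"

definition left_translate :: "'a \<Rightarrow> ('a \<Rightarrow> 'q) \<Rightarrow> 'a \<Rightarrow> 'q" where
  "left_translate g f = (\<lambda>x. f (g \<otimes> x))"

definition conj_translate :: "'a \<Rightarrow> ('a \<Rightarrow> 'q) \<Rightarrow> 'a \<Rightarrow> 'q" where
  "conj_translate t f = (\<lambda>x. f (inv t \<otimes> x \<otimes> t))"

end

text \<open>The filtration is abstract because it is instantiated twice: by the lower central
  series, and in \<open>exists_hom_nonzero\<close> by a filtration of an abelian group that is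
  trivial from index 1 on.\<close>

locale filtered_group = group G for G (structure) +
  fixes F :: "nat \<Rightarrow> 'a set" and c :: nat
  assumes F_0: "F 0 = carrier G"
    and F_normal: "F i \<lhd> G"
    and F_Suc_subset: "F (Suc i) \<subseteq> F i"
    and F_commutator: "\<lbrakk>x \<in> F i; y \<in> F j\<rbrakk> \<Longrightarrow> commutator x y \<in> F (Suc (i + j))"
    and F_end: "F c = {\<one>}"
begin

text \<open>An element of \<open>F w\<close> has weight \<open>w + 1\<close>, and \<open>poly K d\<close> consists of the functions on \<open>K\<close>
  all of whose iterated differences of total weight at least \<open>d\<close> vanish: polynomials of degree
  less than \<open>d\<close>, where \<open>poly K 0\<close> is the zero function. Values off \<open>K\<close> are irrelevant.\<close>

fun poly :: "'a set \<Rightarrow> nat \<Rightarrow> ('a \<Rightarrow> 'q::comm_ring_1) \<Rightarrow> bool" where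
  "poly K 0 f \<longleftrightarrow> (\<forall>x\<in>K. f x = 0)"
| "poly K (Suc d) f \<longleftrightarrow>
     (\<forall>w g. g \<in> K \<inter> F w \<longrightarrow> poly K (d - w) (\<lambda>x. right_translate g f x - f x))"

lemma F_decseq: "i \<le> j \<Longrightarrow> F j \<subseteq> F i"
  using F_Suc_subset by (rule lift_Suc_antimono_le)

lemma F_eq_one: "c \<le> i \<Longrightarrow> x \<in> F i \<Longrightarrow> x = \<one>"
  using F_decseq[of c i] F_end by auto

lemma F_subgroup: "subgroup (F i) G"
  using F_normal by (rule normal_imp_subgroup)

lemma F_closed: "x \<in> F i \<Longrightarrow> x \<in> carrier G"
  using subgroup.mem_carrier[OF F_subgroup] .

lemma poly_zero: "\<forall>x\<in>K. f x = 0 \<Longrightarrow> subgroup K G \<Longrightarrow> poly K d f"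
proof (induction d arbitrary: f rule: less_induct)
  case (less d)
  interpret K: subgroup K G by fact
  show ?case
    using less by (cases d) (auto simp: right_translate_def)
qed

lemma poly_cong: "\<lbrakk>subgroup K G; \<And>x. x \<in> K \<Longrightarrow> f x = g x; poly K d f\<rbrakk> \<Longrightarrow> poly K d g"
proof (induction d arbitrary: f g rule: less_induct)
  case (less d)
  interpret K: subgroup K G by fact
  show ?case
  proof (cases d)
    case 0
    then show ?thesis using less.prems by auto
  next
    case (Suc m)
    show ?thesis
      unfolding Suc poly.simps
    proof (intro allI impI)
      fix w y assume y: "y \<in> K \<inter> F w"
      show "poly K (m - w) (\<lambda>x. right_translate y g x - g x)"
        by (rule less.IH[of _ "\<lambda>x. right_translate y f x - f x"])
          (use Suc y less.prems in \<open>auto simp: right_translate_def\<close>)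
    qed
  qed
qed

text \<open>This makes the recursive clause uniform in \<open>d\<close>:
  \<open>Suc d - Suc w\<close> is \<open>d - w\<close>, and for \<open>d = 0\<close> truncated
  subtraction stays at the zero function.\<close>

lemma poly_diff_step:
  assumes "subgroup K G" "poly K d f" "g \<in> K" "g \<in> F w"
  shows "poly K (d - Suc w) (\<lambda>x. right_translate g f x - f x)"
proof (cases d)
  case 0
  interpret K: subgroup K G by fact
  show ?thesis using assms 0 by (intro poly_zero) (auto simp: right_translate_def)
qed (use assms in auto)

lemma poly_linear:
  fixes f g :: "'a \<Rightarrow> 'q::comm_ring_1"
  assumes "subgroup K G"
  shows "\<lbrakk>poly K d f; poly K d g\<rbrakk> \<Longrightarrow> poly K d (\<lambda>x. p * f x + q * g x)"
proof (induction d arbitrary: f g rule: less_induct)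
  case (less d)
  show ?case
  proof (cases d)
    case 0
    then show ?thesis using less.prems by auto
  next
    case (Suc m)
    show ?thesis
      unfolding Suc poly.simps
    proof (intro allI impI)
      fix w y assume y: "y \<in> K \<inter> F w"
      have "poly K (m - w) (\<lambda>x. p * (right_translate y f x - f x) + q * (right_translate y g x - g x))"
        using less Suc y by simp
      then show "poly K (m - w) (\<lambda>x. right_translate y (\<lambda>x. p * f x + q * g x) x - (p * f x + q * g x))"
        by (simp add: right_translate_def algebra_simps)
    qed
  qed
qed

lemma poly_add: "\<lbrakk>subgroup K G; poly K d f; poly K d g\<rbrakk> \<Longrightarrow> poly K d (\<lambda>x. f x + g x)"
  using poly_linear[of K d f g 1 1] by simp

lemma poly_mono: "\<lbrakk>subgroup K G; poly K d f; d \<le> e\<rbrakk> \<Longrightarrow> poly K e f"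
proof (induction d arbitrary: f e rule: less_induct)
  case (less d)
  interpret K: subgroup K G by fact
  show ?case
  proof (cases d)
    case 0
    then show ?thesis using less.prems by (intro poly_zero) auto
  next
    case (Suc m)
    then obtain k where k: "e = Suc k" "m \<le> k" using less.prems by (cases e) auto
    show ?thesis
      unfolding k poly.simps
    proof (intro allI impI)
      fix w y assume "y \<in> K \<inter> F w"
      then have "poly K (m - w) (\<lambda>x. right_translate y f x - f x)"
        using less.prems(2) Suc by simp
      then show "poly K (k - w) (\<lambda>x. right_translate y f x - f x)"
        using less.IH[of "m - w" _ "k - w"] less.prems(1) Suc k by simp
    qed
  qed
qed

lemma poly_const: "subgroup K G \<Longrightarrow> 0 < d \<Longrightarrow> poly K d (\<lambda>x. q)"
  by (rule poly_mono[of K "Suc 0"]) (auto simp: right_translate_def)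

lemma poly_subset: "\<lbrakk>poly K d f; L \<subseteq> K\<rbrakk> \<Longrightarrow> poly L d f"
proof (induction d arbitrary: f rule: less_induct)
  case (less d)
  then show ?case by (cases d) auto
qed

text \<open>The difference along \<open>y\<close> of the translate by \<open>g\<close> is the
  translate by \<open>g\<close> of the difference along
  \<open>inv g \<otimes> y \<otimes> g\<close>, which has the same weight because \<open>F w\<close>
  is normal.\<close>

lemma poly_right_translate:
  "\<lbrakk>subgroup K G; poly K d f; g \<in> K\<rbrakk> \<Longrightarrow> poly K d (right_translate g f)"
proof (induction d arbitrary: f rule: less_induct)
  case (less d)
  interpret K: subgroup K G by fact
  show ?case
  proof (cases d)
    case 0
    then show ?thesis using less.prems by (auto simp: right_translate_def)
  next
    case (Suc m)
    show ?thesis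
      unfolding Suc poly.simps
    proof (intro allI impI)
      fix w y assume y: "y \<in> K \<inter> F w"
      let ?z = "inv g \<otimes> y \<otimes> g"
      have z: "?z \<in> K" "?z \<in> F w"
        using y less.prems(3) normal_conj(2)[OF F_normal] by auto
      have "poly K (m - w) (right_translate g (\<lambda>x. right_translate ?z f x - f x))"
        by (rule less.IH) (use less.prems z Suc poly_diff_step[of K d f ?z w] in auto)
      then show "poly K (m - w) (\<lambda>x. right_translate y (right_translate g f) x - right_translate g f x)"
        by (rule poly_cong[OF less.prems(1), rotated])
          (use y less.prems in \<open>simp add: right_translate_def word_simps\<close>)
    qed
  qed
qed

lemma poly_conj_translate:
  assumes K: "subgroup K G" and t: "t \<in> normalizer K"
  shows "poly K d f \<Longrightarrow> poly K d (conj_translate t f)"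
proof (induction d arbitrary: f rule: less_induct)
  case (less d)
  interpret K: subgroup K G by fact
  have tc: "t \<in> carrier G" using t by (rule normalizer_closed)
  show ?case
  proof (cases d)
    case 0
    then show ?thesis using less.prems normalizer_conj_iff[OF t] by (auto simp: conj_translate_def)
  next
    case (Suc m)
    show ?thesis
      unfolding Suc poly.simps
    proof (intro allI impI)
      fix w y assume y: "y \<in> K \<inter> F w"
      let ?z = "inv t \<otimes> y \<otimes> t"
      have z: "?z \<in> K" "?z \<in> F w"
        using y tc normalizer_conj_iff[OF t] normal_conj(2)[OF F_normal] by auto
      have "poly K (m - w) (conj_translate t (\<lambda>x. right_translate ?z f x - f x))"
        by (rule less.IH) (use less.prems z Suc poly_diff_step[of K d f ?z w] K in auto)
      then show "poly K (m - w) (\<lambda>x. right_translate y (conj_translate t f) x - conj_translate t f x)"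
        by (rule poly_cong[OF K, rotated])
          (use y tc in \<open>simp add: right_translate_def conj_translate_def word_simps\<close>)
    qed
  qed
qed

text \<open>Conjugation moves \<open>y\<close> to \<open>y \<otimes> e y\<close>. The commutator
  \<open>e y\<close> lies in \<open>K\<close> because \<open>t\<close> normalizes \<open>K\<close>,
  and it has at least the sum of the weights of \<open>y\<close> and \<open>t\<close>. The extension
  steps use this for \<open>t\<close> outside \<open>K\<close>.\<close>

lemma poly_conj_translate_diff:
  fixes f :: "'a \<Rightarrow> 'q::comm_ring_1"
  assumes K: "subgroup K G" and t: "t \<in> normalizer K" "t \<in> F w"
  shows "poly K d f \<Longrightarrow> poly K (d - Suc w) (\<lambda>x. conj_translate t f x - f x)"
proof (induction d arbitrary: f rule: less_induct)
  case (less d)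
  interpret K: subgroup K G by fact
  have tc: "t \<in> carrier G" using t(1) by (rule normalizer_closed)
  define e where "e y = inv y \<otimes> inv t \<otimes> y \<otimes> t" for y
  have e: "e y \<in> K" "e y \<in> F (Suc (v + w))" "y \<otimes> e y = inv t \<otimes> y \<otimes> t" if "y \<in> K" "y \<in> F v" for y v
  proof -
    have y: "y \<in> carrier G" using that by simp
    have "inv y \<otimes> (inv t \<otimes> y \<otimes> t) \<in> K"
      using K.m_closed[OF K.m_inv_closed[OF that(1)]] that(1) normalizer_conj_iff[OF t(1) y] by blast
    then show "e y \<in> K" using y tc by (simp add: e_def m_assoc)
    have "commutator (inv y) (inv t) \<in> F (Suc (v + w))"
      using that(2) t(2) F_commutator subgroup.m_inv_closed[OF F_subgroup] by blast
    then show "e y \<in> F (Suc (v + w))" using y tc by (simp add: e_def commutator_def)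
    show "y \<otimes> e y = inv t \<otimes> y \<otimes> t" using y tc by (simp add: e_def word_simps)
  qed
  show ?case
  proof (cases "d \<le> Suc w")
    case True
    \<comment> \<open>Here \<open>d\<close> is at most the weight \<open>Suc w\<close> of
      \<open>t\<close>, and \<open>e x\<close> has at least this weight, so \<open>f\<close> does
      not change along \<open>e x\<close>.\<close>
    have "f (inv t \<otimes> x \<otimes> t) = f x" if x: "x \<in> K" for x
    proof -
      have "e x \<in> F w" using e(2)[of x 0] x F_0 F_decseq[of w "Suc (0 + w)"] by auto
      then have "poly K 0 (\<lambda>y. right_translate (e x) f y - f y)"
        using poly_diff_step[OF K less.prems, of "e x" w] e(1)[of x 0] x F_0 True by simp
      then have "f (x \<otimes> e x) = f x" using x by (simp add: right_translate_def)
      then show ?thesis using x e(3)[of x 0] F_0 by simp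
    qed
    then show ?thesis using True by (simp add: conj_translate_def)
  next
    case False
    then have m: "d - Suc w = Suc m" "d = Suc (Suc (m + w))" if "m = d - Suc (Suc w)" for m
      using that by auto
    define m where "m = d - Suc (Suc w)"
    note m = m[OF m_def]
    show ?thesis
      unfolding m(1) poly.simps
    proof (intro allI impI)
      fix v y assume y: "y \<in> K \<inter> F v"
      then have ey: "e y \<in> K" "e y \<in> F (Suc (v + w))" "y \<otimes> e y = inv t \<otimes> y \<otimes> t" using e[of y v] by auto
      \<comment> \<open>With C for conjugation and R for right translation, the difference along
        \<open>y\<close> of (C - 1) f splits into C R_y (R_(e y) - 1) f, treated here, and (C -
        1)(R_y - 1) f, which falls to the induction hypothesis.\<close>
      have 1: "poly K (m - v) (conj_translate t (right_translate y (\<lambda>x. right_translate (e y) f x - f x)))"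
        using poly_diff_step[OF K less.prems ey(1,2)] y m
        by (intro poly_conj_translate[OF K t(1)] poly_right_translate[OF K]) (auto simp: add.commute)
      let ?g = "\<lambda>x. right_translate y f x - f x"
      have "poly K (d - Suc v - Suc w) (\<lambda>x. conj_translate t ?g x - ?g x)"
        using less.IH[of "d - Suc v" ?g] poly_diff_step[OF K less.prems, of y v] y m by simp
      moreover have "d - Suc v - Suc w = m - v" using m by simp
      ultimately have 2: "poly K (m - v) (\<lambda>x. conj_translate t ?g x - ?g x)" by simp
      show "poly K (m - v) (\<lambda>x. right_translate y (\<lambda>x. conj_translate t f x - f x) x - (conj_translate t f x - f x))"
      proof (rule poly_cong[OF K _ poly_add[OF K 1 2]])
        fix x assume x: "x \<in> K"
        have "inv t \<otimes> (x \<otimes> y) \<otimes> t = (inv t \<otimes> x \<otimes> t) \<otimes> (inv t \<otimes> y \<otimes> t)"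
          using x y tc by (simp add: word_simps)
        also have "\<dots> = (inv t \<otimes> x \<otimes> t) \<otimes> y \<otimes> e y"
          using x y ey tc by (simp add: m_assoc)
        finally show "conj_translate t (right_translate y (\<lambda>x. right_translate (e y) f x - f x)) x +
            (conj_translate t ?g x - ?g x)
          = right_translate y (\<lambda>x. conj_translate t f x - f x) x - (conj_translate t f x - f x)"
          by (simp add: right_translate_def conj_translate_def)
      qed
    qed
  qed
qed

text \<open>This transfers degree bounds from right translations and conjugations to left
  translations, by which the group acts on the module.\<close>

lemma left_translate_eq:
  assumes "subgroup K G" "u \<in> K" "x \<in> K"
  shows "left_translate u f x = right_translate u (conj_translate (inv u) f) x"
proof -
  interpret K: subgroup K G by fact
  show ?thesis using assms by (simp add: left_translate_def right_translate_def conj_translate_def word_simps)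
qed

lemma poly_left_translate_diff:
  assumes K: "subgroup K G" and u: "u \<in> K" "u \<in> F w" and f: "poly K d f"
  shows "poly K (d - Suc w) (\<lambda>x. left_translate u f x - f x)"
proof -
  interpret K: subgroup K G by fact
  let ?g = "conj_translate (inv u) f"
  have iu: "inv u \<in> normalizer K" "inv u \<in> F w"
    using u subgroup_subset_normalizer[OF K] subgroup.m_inv_closed[OF F_subgroup] by auto
  have "poly K (d - Suc w) (\<lambda>x. (right_translate u ?g x - ?g x) + (?g x - f x))"
    using poly_diff_step[OF K poly_conj_translate[OF K iu(1) f] u] poly_conj_translate_diff[OF K iu f]
    by (rule poly_add[OF K])
  then show ?thesis
    by (rule poly_cong[OF K, rotated]) (simp add: left_translate_eq[OF K u(1)])
qed

text \<open>A difference of the values on one member may be taken along an element \<open>y\<close>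
  of another; the chain has a member containing both, and the condition is inherited from
  it.\<close>

lemma poly_Union:
  assumes "\<And>K L. \<lbrakk>K \<in> \<K>; L \<in> \<K>\<rbrakk> \<Longrightarrow> K \<subseteq> L \<or> L \<subseteq> K"
  shows "(\<And>K. K \<in> \<K> \<Longrightarrow> poly K d f) \<Longrightarrow> poly (\<Union>\<K>) d f"
proof (induction d arbitrary: f rule: less_induct)
  case (less d)
  show ?case
  proof (cases d)
    case 0
    then show ?thesis using less.prems by auto
  next
    case (Suc m)
    show ?thesis
      unfolding Suc poly.simps
    proof (intro allI impI)
      fix w y assume y: "y \<in> \<Union>\<K> \<inter> F w"
      then obtain L where L: "L \<in> \<K>" "y \<in> L" by auto
      show "poly (\<Union>\<K>) (m - w) (\<lambda>x. right_translate y f x - f x)"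
      proof (rule less.IH)
        fix K assume K: "K \<in> \<K>"
        then obtain M where M: "M \<in> \<K>" "K \<subseteq> M" "y \<in> M" using assms[OF K L(1)] L by auto
        then have "poly M (m - w) (\<lambda>x. right_translate y f x - f x)"
          using less.prems[OF M(1)] y Suc by auto
        then show "poly K (m - w) (\<lambda>x. right_translate y f x - f x)"
          using M(2) by (rule poly_subset)
      qed (use Suc in auto)
    qed
  qed
qed

end

section \<open>Extending polynomial functions to larger subgroups\<close>

locale filtered_pair = filtered_group +
  fixes H :: "'a set"
  assumes H_normal: "H \<lhd> G"
begin

lemma H_subgroup: "subgroup H G"
  using H_normal by (rule normal_imp_subgroup)

lemma H_closed: "h \<in> H \<Longrightarrow> h \<in> carrier G"
  using subgroup.mem_carrier[OF H_subgroup] .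

text \<open>In terms of the action by left translations: (h - 1)(h' - 1) kills \<open>f\<close> at
  the points of \<open>K\<close>.\<close>

definition affine :: "'a set \<Rightarrow> ('a \<Rightarrow> 'q::comm_ring_1) \<Rightarrow> bool" where
  "affine K f \<longleftrightarrow> (\<forall>h\<in>H. \<forall>h'\<in>H. \<forall>x\<in>K. f (h \<otimes> (h' \<otimes> x)) = f (h \<otimes> x) + f (h' \<otimes> x) - f x)"

definition good :: "'a set \<Rightarrow> nat \<Rightarrow> ('a \<Rightarrow> 'q::comm_ring_1) \<Rightarrow> bool" where
  "good K d f \<longleftrightarrow> poly K d f \<and> affine K f"

lemma good_linear:
  assumes "subgroup K G" "good K d f" "good K d g"
  shows "good K d (\<lambda>x. p * f x + q * g x)"
proof -
  have "affine K (\<lambda>x. p * f x + q * g x)"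
    unfolding affine_def
  proof (intro ballI)
    fix h h' x assume "h \<in> H" "h' \<in> H" "x \<in> K"
    then have eqs: "f (h \<otimes> (h' \<otimes> x)) = f (h \<otimes> x) + f (h' \<otimes> x) - f x"
      "g (h \<otimes> (h' \<otimes> x)) = g (h \<otimes> x) + g (h' \<otimes> x) - g x"
      using assms(2,3) by (auto simp: good_def affine_def)
    show "p * f (h \<otimes> (h' \<otimes> x)) + q * g (h \<otimes> (h' \<otimes> x))
        = p * f (h \<otimes> x) + q * g (h \<otimes> x) + (p * f (h' \<otimes> x) + q * g (h' \<otimes> x)) - (p * f x + q * g x)"
      by (simp only: eqs) (simp add: algebra_simps)
  qed
  then show ?thesis using assms poly_linear[OF assms(1)] unfolding good_def by blast
qed

lemma good_add: "\<lbrakk>subgroup K G; good K d f; good K d g\<rbrakk> \<Longrightarrow> good K d (\<lambda>x. f x + g x)"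
  using good_linear[of K d f g 1 1] by simp

lemma good_scale: "\<lbrakk>subgroup K G; good K d f\<rbrakk> \<Longrightarrow> good K d (\<lambda>x. q * f x)"
  using good_linear[of K d f f q 0] by simp

lemma good_diff: "\<lbrakk>subgroup K G; good K d f; good K d g\<rbrakk> \<Longrightarrow> good K d (\<lambda>x. f x - g x)"
  using good_linear[of K d f g 1 "-1"] by simp

lemma good_zero: "subgroup K G \<Longrightarrow> good K d (\<lambda>x. 0)"
  by (simp add: good_def affine_def poly_zero)

lemma good_sum:
  assumes "subgroup K G" "\<And>i. i \<in> I \<Longrightarrow> good K d (f i)"
  shows "good K d (\<lambda>x. \<Sum>i\<in>I. f i x)"
  using assms(2)
  by (induction I rule: infinite_finite_induct) (auto simp: good_zero good_add assms(1))

lemma good_mono: "\<lbrakk>subgroup K G; good K d f; d \<le> e\<rbrakk> \<Longrightarrow> good K e f"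
  using poly_mono unfolding good_def by blast

lemma good_0_iff:
  assumes "subgroup K G" "H \<subseteq> K"
  shows "good K 0 f \<longleftrightarrow> (\<forall>x\<in>K. f x = 0)"
proof -
  interpret K: subgroup K G by fact
  show ?thesis using assms(2) by (auto simp: good_def affine_def subset_iff)
qed

lemma good_cong:
  assumes "subgroup K G" "H \<subseteq> K" "\<And>x. x \<in> K \<Longrightarrow> f x = g x" "good K d f"
  shows "good K d g"
proof -
  interpret K: subgroup K G by fact
  show ?thesis
    using assms(2-4) poly_cong[OF assms(1), of f g d] by (auto simp: good_def affine_def subset_iff)
qed

lemma good_right_translate:
  assumes "subgroup K G" "H \<subseteq> K" "good K d f" "g \<in> K"
  shows "good K d (right_translate g f)"
proof -
  interpret K: subgroup K G by fact
  show ?thesis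
    using assms poly_right_translate[OF assms(1)] H_closed
    by (auto simp: good_def affine_def right_translate_def m_assoc)
qed

lemma good_conj_translate:
  assumes "subgroup K G" "H \<subseteq> K" "good K d f" "t \<in> normalizer K"
  shows "good K d (conj_translate t f)"
proof -
  interpret K: subgroup K G by fact
  have tc: "t \<in> carrier G" using assms(4) by (rule normalizer_closed)
  have "affine K (conj_translate t f)"
    unfolding affine_def
  proof (intro ballI)
    fix h h' x assume hx: "h \<in> H" "h' \<in> H" "x \<in> K"
    have c: "h \<in> carrier G" "h' \<in> carrier G" "x \<in> carrier G" using hx H_closed by auto
    let ?k = "inv t \<otimes> h \<otimes> t" and ?k' = "inv t \<otimes> h' \<otimes> t" and ?y = "inv t \<otimes> x \<otimes> t"
    have "?k \<in> H" "?k' \<in> H" "?y \<in> K"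
      using hx tc c normal_conj(2)[OF H_normal] normalizer_conj_iff[OF assms(4)] by auto
    then have "f (?k \<otimes> (?k' \<otimes> ?y)) = f (?k \<otimes> ?y) + f (?k' \<otimes> ?y) - f ?y"
      using assms(3) by (simp add: good_def affine_def)
    then show "conj_translate t f (h \<otimes> (h' \<otimes> x))
        = conj_translate t f (h \<otimes> x) + conj_translate t f (h' \<otimes> x) - conj_translate t f x"
      using c tc by (simp add: conj_translate_def word_simps)
  qed
  then show ?thesis using assms poly_conj_translate[OF assms(1,4)] unfolding good_def by blast
qed

lemma good_left_translate:
  assumes "subgroup K G" "H \<subseteq> K" "good K d f" "u \<in> K"
  shows "good K d (left_translate u f)"
proof -
  interpret K: subgroup K G by fact
  have "inv u \<in> normalizer K" using assms(4) subgroup_subset_normalizer[OF assms(1)] by auto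
  then have "good K d (right_translate u (conj_translate (inv u) f))"
    using assms by (intro good_right_translate good_conj_translate)
  then show ?thesis
    by (rule good_cong[OF assms(1,2), rotated]) (simp add: left_translate_eq[OF assms(1,4)])
qed

lemma good_right_translate_diff:
  assumes "subgroup K G" "H \<subseteq> K" "good K d f" "g \<in> K" "g \<in> F w"
  shows "good K (d - Suc w) (\<lambda>x. right_translate g f x - f x)"
  using good_diff[OF assms(1) good_right_translate[OF assms(1-4)] assms(3)]
    poly_diff_step[OF assms(1) _ assms(4,5)] assms(3) unfolding good_def by blast

lemma good_conj_translate_diff:
  assumes "subgroup K G" "H \<subseteq> K" "good K d f" "t \<in> normalizer K" "t \<in> F w"
  shows "good K (d - Suc w) (\<lambda>x. conj_translate t f x - f x)"
  using good_diff[OF assms(1) good_conj_translate[OF assms(1-4)] assms(3)]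
    poly_conj_translate_diff[OF assms(1) assms(4,5)] assms(3) unfolding good_def by blast

lemma good_left_translate_diff:
  assumes "subgroup K G" "H \<subseteq> K" "good K d f" "u \<in> K" "u \<in> F w"
  shows "good K (d - Suc w) (\<lambda>x. left_translate u f x - f x)"
  using good_diff[OF assms(1) good_left_translate[OF assms(1-4)] assms(3)]
    poly_left_translate_diff[OF assms(1) assms(4,5)] assms(3) unfolding good_def by blast

end

text \<open>\<open>T a f\<close> plays the role of the restriction to \<open>K\<close> of the right translate by \<open>t\<^sup>a\<close> of the
  extension of \<open>f\<close> that is to be constructed.\<close>

locale extension_step = filtered_pair +
  fixes K :: "'a set" and t :: 'a and N :: nat and T :: "int \<Rightarrow> ('a \<Rightarrow> 'q::comm_ring_1) \<Rightarrow> 'a \<Rightarrow> 'q"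
  assumes K: "subgroup K G" and HK: "H \<subseteq> K" and t: "t \<in> normalizer K"
    and T_cong: "\<lbrakk>\<And>x. x \<in> K \<Longrightarrow> f x = g x; x \<in> K\<rbrakk> \<Longrightarrow> T a f x = T a g x"
    and T_diff: "T a (\<lambda>x. f x - g x) x = T a f x - T a g x"
    and T_good: "\<lbrakk>d \<le> N; good K d f\<rbrakk> \<Longrightarrow> good K d (T a f)"
    and T_add: "\<lbrakk>good K N f; x \<in> K\<rbrakk> \<Longrightarrow> T (a + b) f x = T a (T b f) x"
    and T_right_translate: "\<lbrakk>y \<in> K; x \<in> K\<rbrakk>
      \<Longrightarrow> T a (right_translate y f) x = T a f (x \<otimes> (t [^] a \<otimes> y \<otimes> inv (t [^] a)))"
    and T_mem: "\<lbrakk>t [^] a \<in> K; good K N f; x \<in> K\<rbrakk> \<Longrightarrow> T a f x = f (x \<otimes> t [^] a)"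
    and T_lower: "\<lbrakk>d \<le> N; good K d f; y \<in> K; y \<otimes> t [^] a \<in> F w\<rbrakk>
      \<Longrightarrow> good K (d - Suc w) (\<lambda>x. right_translate y (T a f) x - f x)"
begin

lemmas K_mult = subgroup.m_closed[OF K] and K_inv = subgroup.m_inv_closed[OF K]
  and K_closed = subgroup.mem_carrier[OF K] and K_one = subgroup.one_closed[OF K]

definition adjoined :: "'a set" where
  "adjoined = {x \<otimes> t [^] a | x a. x \<in> K \<and> (a::int) \<in> UNIV}"

text \<open>The \<open>K\<close> factor stands on the left, so that left multiplication by
  \<open>H\<close> touches this factor alone and affineness passes from \<open>T a f\<close> to the
  extension.\<close>

definition ext :: "('a \<Rightarrow> 'q) \<Rightarrow> 'a \<Rightarrow> 'q" where
  "ext f z = (THE r. \<exists>x\<in>K. \<exists>a. z = x \<otimes> t [^] (a::int) \<and> r = T a f x)"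

lemma t_closed [simp]: "t \<in> carrier G"
  using t by (rule normalizer_closed)

lemma t_pow: "t [^] (a::int) \<in> normalizer K"
  using subgroup_int_pow_closed[OF subgroup_normalizer t] .

lemma t_pow_conj: "y \<in> K \<Longrightarrow> t [^] (a::int) \<otimes> y \<otimes> inv (t [^] a) \<in> K"
  using normalizer_conj_iff'[OF t_pow] K_closed by blast

lemma adjoined_mult:
  assumes "x \<in> K" "y \<in> K"
  shows "(x \<otimes> t [^] (a::int)) \<otimes> (y \<otimes> t [^] b) = x \<otimes> (t [^] a \<otimes> y \<otimes> inv (t [^] a)) \<otimes> t [^] (a + b)"
  using assms[THEN K_closed] by (simp add: word_simps int_pow_mult)

lemma adjoinedI: "x \<in> K \<Longrightarrow> x \<otimes> t [^] (a::int) \<in> adjoined"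
  by (auto simp: adjoined_def)

lemma subgroup_adjoined: "subgroup adjoined G"
proof (rule subgroupI)
  show "adjoined \<subseteq> carrier G" using K_closed by (auto simp: adjoined_def)
  show "adjoined \<noteq> {}" using adjoinedI[OF K_one] by blast
next
  fix z assume "z \<in> adjoined"
  then obtain x a where z: "z = x \<otimes> t [^] (a::int)" "x \<in> K" by (auto simp: adjoined_def)
  have "inv z = (t [^] (-a) \<otimes> inv x \<otimes> inv (t [^] (-a))) \<otimes> t [^] (-a)"
    using K_closed[OF z(2)] by (simp add: z(1) word_simps int_pow_neg)
  then show "inv z \<in> adjoined" using adjoinedI[OF t_pow_conj[OF K_inv[OF z(2)]]] by metis
next
  fix z z' assume "z \<in> adjoined" "z' \<in> adjoined"
  then obtain x a y b where z: "z = x \<otimes> t [^] (a::int)" "x \<in> K" "z' = y \<otimes> t [^] (b::int)" "y \<in> K"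
    by (auto simp: adjoined_def)
  show "z \<otimes> z' \<in> adjoined"
    unfolding z(1,3) adjoined_mult[OF z(2,4)]
    using adjoinedI[OF K_mult[OF z(2) t_pow_conj[OF z(4)]]] .
qed

lemma subset_adjoined: "K \<subseteq> adjoined"
  using adjoinedI[of _ 0] K_closed by fastforce

text \<open>Two representations differ by \<open>?s\<close>, a power of \<open>t\<close> inside
  \<open>K\<close>. For such a power \<open>T\<close> is the actual right translation, and
  \<open>?s\<close> commutes with \<open>t [^] b\<close>.\<close>

lemma T_well_defined:
  assumes f: "good K N f" and xy: "x \<in> K" "y \<in> K" and eq: "x \<otimes> t [^] (a::int) = y \<otimes> t [^] b"
  shows "T a f x = T b f y"
proof -
  have c: "x \<in> carrier G" "y \<in> carrier G" using xy K_closed by auto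
  let ?s = "t [^] (a - b)"
  have "x \<otimes> t [^] a \<otimes> inv (t [^] b) = y \<otimes> t [^] b \<otimes> inv (t [^] b)" by (simp add: eq)
  then have xs: "x \<otimes> ?s = y" using c by (simp add: m_assoc int_pow_diff)
  have "inv x \<otimes> (x \<otimes> ?s) = ?s" using c by (simp add: inv_mult_cancel)
  then have s: "?s \<in> K" using K_mult[OF K_inv[OF xy(1)] xy(2)] xs by simp
  have "t [^] b \<otimes> ?s = ?s \<otimes> t [^] b" by (simp add: int_pow_mult[symmetric] add.commute)
  then have tst: "t [^] b \<otimes> ?s \<otimes> inv (t [^] b) = ?s" by (simp add: m_assoc)
  have "T a f x = T (b + (a - b)) f x" by simp
  also have "\<dots> = T b (T (a - b) f) x" using f xy(1) by (rule T_add)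
  also have "\<dots> = T b (right_translate ?s f) x"
    by (rule T_cong[OF _ xy(1)]) (simp add: T_mem[OF s f] right_translate_def)
  also have "\<dots> = T b f y"
    using T_right_translate[OF s xy(1), of b f] by (simp add: tst xs)
  finally show ?thesis .
qed

lemma ext_eq:
  assumes "good K N f" "x \<in> K"
  shows "ext f (x \<otimes> t [^] (a::int)) = T a f x"
  unfolding ext_def
proof (rule the_equality)
  show "\<exists>y\<in>K. \<exists>b. x \<otimes> t [^] a = y \<otimes> t [^] (b::int) \<and> T a f x = T b f y"
    using assms(2) by blast
next
  fix r assume "\<exists>y\<in>K. \<exists>b. x \<otimes> t [^] a = y \<otimes> t [^] (b::int) \<and> r = T b f y"
  then obtain y b where y: "y \<in> K" "x \<otimes> t [^] a = y \<otimes> t [^] (b::int)" "r = T b f y" by blast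
  show "r = T a f x" using T_well_defined[OF assms y(1,2)] y(3) by simp
qed

lemma ext_eq_on: "\<lbrakk>good K N f; x \<in> K\<rbrakk> \<Longrightarrow> ext f x = f x"
  using ext_eq[of f x 0] T_mem[of 0 f x] by (simp add: K_one K_closed)

text \<open>The difference of \<open>ext f\<close> along \<open>y \<otimes> t [^] a\<close> is
  itself an extension, namely that of \<open>right_translate y (T a f) x - f x\<close> as a function
  of \<open>x\<close>. \<open>T_lower\<close> bounds the degree of this function, so the induction
  applies to it.\<close>

lemma poly_ext: "\<lbrakk>d \<le> N; good K d f\<rbrakk> \<Longrightarrow> poly adjoined d (ext f)"
proof (induction d arbitrary: f rule: less_induct)
  case (less d)
  have fN: "good K N f" using good_mono[OF K less.prems(2,1)] .
  show ?case
  proof (cases d)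
    case 0
    then have "T a f x = 0" if "x \<in> K" for a x
      using T_good[OF less.prems] good_0_iff[OF K HK] that by auto
    then show ?thesis using 0 ext_eq[OF fN] by (auto simp: adjoined_def)
  next
    case (Suc m)
    show ?thesis
      unfolding Suc poly.simps
    proof (intro allI impI)
      fix w g assume g: "g \<in> adjoined \<inter> F w"
      then obtain y a where y: "g = y \<otimes> t [^] (a::int)" "y \<in> K" by (auto simp: adjoined_def)
      define r where "r = right_translate y (T a f)"
      have r: "good K N r"
        unfolding r_def using T_good[OF order_refl fN] y(2) by (intro good_right_translate[OF K HK])
      have d: "good K (d - Suc w) (\<lambda>x. r x - f x)"
        unfolding r_def using T_lower[OF less.prems] y g by auto
      have dN: "good K N (\<lambda>x. r x - f x)" using good_diff[OF K r fN] .
      have "poly adjoined (m - w) (ext (\<lambda>x. r x - f x))"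
        using less.IH[of "m - w"] d Suc less.prems(1) by auto
      then show "poly adjoined (m - w) (\<lambda>x. right_translate g (ext f) x - ext f x)"
      proof (rule poly_cong[OF subgroup_adjoined, rotated])
        fix z assume "z \<in> adjoined"
        then obtain x b where z: "z = x \<otimes> t [^] (b::int)" "x \<in> K" by (auto simp: adjoined_def)
        let ?c = "t [^] b \<otimes> y \<otimes> inv (t [^] b)"
        have xc: "x \<otimes> ?c \<in> K" using K_mult[OF z(2) t_pow_conj[OF y(2)]] .
        have "ext f (z \<otimes> g) = T (b + a) f (x \<otimes> ?c)"
          unfolding z(1) y(1) adjoined_mult[OF z(2) y(2)] using xc by (rule ext_eq[OF fN])
        also have "\<dots> = T b (T a f) (x \<otimes> ?c)" using fN xc by (rule T_add)
        also have "\<dots> = T b r x" unfolding r_def using T_right_translate[OF y(2) z(2)] by simp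
        finally show "ext (\<lambda>x. r x - f x) z = right_translate g (ext f) z - ext f z"
          using ext_eq[OF dN z(2)] ext_eq[OF fN z(2)] by (simp add: z(1) T_diff right_translate_def)
      qed
    qed
  qed
qed

lemma good_ext:
  assumes f: "good K N f"
  shows "good adjoined N (ext f)"
proof -
  have "affine adjoined (ext f)"
    unfolding affine_def
  proof (intro ballI)
    fix h h' z assume h: "h \<in> H" "h' \<in> H" and "z \<in> adjoined"
    then obtain x a where z: "z = x \<otimes> t [^] (a::int)" "x \<in> K" by (auto simp: adjoined_def)
    have hK: "h \<in> K" "h' \<in> K" using h HK by auto
    have "affine K (T a f)" using T_good[OF order_refl f] by (simp add: good_def)
    then have "T a f (h \<otimes> (h' \<otimes> x)) = T a f (h \<otimes> x) + T a f (h' \<otimes> x) - T a f x"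
      using h z(2) by (simp add: affine_def)
    then show "ext f (h \<otimes> (h' \<otimes> z)) = ext f (h \<otimes> z) + ext f (h' \<otimes> z) - ext f z"
      using ext_eq[OF f, symmetric] K_mult hK z(2) K_closed by (simp add: z(1) m_assoc)
  qed
  then show ?thesis using poly_ext[OF order_refl f] by (simp add: good_def)
qed

end

text \<open>With this \<open>T\<close> the extension ignores powers of \<open>t\<close> on the left.
  The delicate point is the degree drop along \<open>y \<otimes> t [^] a\<close> in
  \<open>F w\<close>: by \<open>max\<close>, for nonzero \<open>a\<close>, the level
  \<open>w\<close> does not exceed that of \<open>t\<close>, so both factors lie in
  \<open>F w\<close> and their drops can be estimated separately.\<close>

lemma (in filtered_pair) extension_step_infinite_order:
  fixes T :: "int \<Rightarrow> ('a \<Rightarrow> 'q::comm_ring_1) \<Rightarrow> 'a \<Rightarrow> 'q"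
  assumes K: "subgroup K G" and HK: "H \<subseteq> K" and t: "t \<in> normalizer K" "t \<in> F v"
    and inf: "\<And>a::int. t [^] a \<in> K \<Longrightarrow> a = 0"
    and max: "\<And>a y w. \<lbrakk>a \<noteq> 0; y \<in> K; y \<otimes> t [^] (a::int) \<in> F w\<rbrakk> \<Longrightarrow> w \<le> v"
    and T_def: "\<And>a. T a = conj_translate (t [^] a)"
  shows "extension_step G F c H K t N T"
proof (intro extension_step.intro extension_step_axioms.intro filtered_pair_axioms)
  have tc: "t \<in> carrier G" using t(1) by (rule normalizer_closed)
  note Kc = subgroup.mem_carrier[OF K]
  have ta: "t [^] a \<in> normalizer K" for a :: int
    using subgroup_int_pow_closed[OF subgroup_normalizer t(1)] .
  show "T a f x = T a g x" if "\<And>x. x \<in> K \<Longrightarrow> f x = g x" "x \<in> K" for a f g x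
    using that normalizer_conj_iff[OF ta Kc[OF that(2)]] by (simp add: T_def conj_translate_def)
  show "T a (\<lambda>x. f x - g x) x = T a f x - T a g x" for a f g x
    by (simp add: T_def conj_translate_def)
  show "good K d (T a f)" if "good K d f" for a d f
    unfolding T_def using K HK that ta by (rule good_conj_translate)
  show "T (a + b) f x = T a (T b f) x" if "x \<in> K" for a b f x
    using Kc[OF that] tc by (simp add: T_def conj_translate_def int_pow_mult word_simps)
  show "T a (right_translate y f) x = T a f (x \<otimes> (t [^] a \<otimes> y \<otimes> inv (t [^] a)))"
    if "y \<in> K" "x \<in> K" for a f x y
    using Kc[OF that(1)] Kc[OF that(2)] tc
    by (simp add: T_def conj_translate_def right_translate_def word_simps)
  show "T a f x = f (x \<otimes> t [^] a)" if "t [^] a \<in> K" "x \<in> K" for a f x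
    using inf[OF that(1)] Kc[OF that(2)] by (simp add: T_def conj_translate_def)
  show "good K (d - Suc w) (\<lambda>x. right_translate y (T a f) x - f x)"
    if f: "good K d f" and y: "y \<in> K" "y \<otimes> t [^] a \<in> F w" for d f y a w
  proof -
    have yc: "y \<in> carrier G" using Kc[OF y(1)] .
    have w: "t [^] a \<in> F w \<and> y \<in> F w"
    proof (cases "a = 0")
      case True
      then show ?thesis using y yc subgroup.one_closed[OF F_subgroup] by simp
    next
      case False
      then have "t \<in> F w" using max[OF _ y] F_decseq[of w v] t(2) by blast
      then have 1: "t [^] a \<in> F w" using subgroup_int_pow_closed[OF F_subgroup] by blast
      have "y \<otimes> t [^] a \<otimes> inv (t [^] a) \<in> F w"
        using subgroup.m_closed[OF F_subgroup y(2) subgroup.m_inv_closed[OF F_subgroup 1]] .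
      moreover have "y \<otimes> t [^] a \<otimes> inv (t [^] a) = y" using tc yc by (simp add: m_assoc)
      ultimately show ?thesis using 1 by simp
    qed
    have "good K d (T a f)" unfolding T_def using K HK f ta by (rule good_conj_translate)
    then have "good K (d - Suc w) (\<lambda>x. right_translate y (T a f) x - T a f x)"
      using K HK y(1) w by (intro good_right_translate_diff) auto
    moreover have "good K (d - Suc w) (\<lambda>x. T a f x - f x)"
      unfolding T_def using K HK f ta w by (intro good_conj_translate_diff) auto
    ultimately show ?thesis using good_add[OF K] by fastforce
  qed
qed (use assms in auto)

text \<open>Modulo the square of \<open>\<rho> - 1\<close>, the operator \<open>\<rho>\<^sup>m - 1\<close> equals \<open>m (\<rho> - 1)\<close>.\<close>

lemma (in filtered_pair) lower_if_power_lower: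
  fixes \<rho> :: "('a \<Rightarrow> 'q::field_char_0) \<Rightarrow> 'a \<Rightarrow> 'q"
  assumes K: "subgroup K G" and "0 < m"
    and diff: "\<And>f g x. \<rho> (\<lambda>x. f x - g x) x = \<rho> f x - \<rho> g x"
    and pres: "\<And>d f. \<lbrakk>d \<le> N; good K d f\<rbrakk> \<Longrightarrow> good K d (\<rho> f)"
    and low: "\<And>d f. \<lbrakk>d \<le> N; good K d f\<rbrakk> \<Longrightarrow> good K (d - 1) (\<lambda>x. \<rho> f x - f x)"
    and pow: "\<And>d f. \<lbrakk>d \<le> N; good K d f\<rbrakk> \<Longrightarrow> good K (d - Suc w) (\<lambda>x. (\<rho> ^^ m) f x - f x)"
    and "d \<le> N" "good K d f"
  shows "good K (d - Suc w) (\<lambda>x. \<rho> f x - f x)"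
proof -
  \<comment> \<open>The drop improves one unit at a time up to \<open>Suc w\<close>. If
    \<open>\<rho>\<close> minus the identity lowers the degree by \<open>Suc v\<close>, its square
    lowers it by at least one more; for \<open>v\<close> below \<open>w\<close> so does
    \<open>\<rho> ^^ m\<close> minus the identity.\<close>
  have "good K (d - Suc v) (\<lambda>x. \<rho> f x - f x)" if "d \<le> N" "good K d f" "v \<le> w" for d f v
    using that
  proof (induction v arbitrary: d f)
    case 0
    then show ?case using low by simp
  next
    case (Suc v)
    note IH = Suc.IH and prems = Suc.prems
    have p: "good K d ((\<rho> ^^ i) f)" for i
      by (induction i) (use Suc.prems pres in auto)
    have 1: "good K (d - Suc v) (\<lambda>x. (\<rho> ^^ i) f x - f x)" for i
    proof (induction i)
      case 0
      then show ?case using good_zero[OF K] by simp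
    next
      case (Suc i)
      then show ?case
        using good_add[OF K Suc IH[of d, OF _ p[of i]]] prems
        by (simp add: algebra_simps)
    qed
    have 2: "good K (d - Suc v - Suc v) (\<lambda>x. (\<rho> ^^ i) f x - f x - of_nat i * (\<rho> f x - f x))" for i
    proof (induction i)
      case 0
      then show ?case using good_zero[OF K] by simp
    next
      case (Suc i)
      \<comment> \<open>The increment is \<open>\<rho>\<close> minus the identity applied to a
        function whose degree has already dropped by fact \<open>1\<close>.\<close>
      have "good K (d - Suc v - Suc v) (\<lambda>x. \<rho> (\<lambda>x. (\<rho> ^^ i) f x - f x) x - ((\<rho> ^^ i) f x - f x))"
        using prems by (intro IH 1) auto
      from good_add[OF K Suc this] show ?case
        by (simp add: diff algebra_simps)
    qed
    have 3: "good K (d - Suc (Suc v)) (\<lambda>x. (\<rho> ^^ m) f x - f x)"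
      using pow[OF Suc.prems(1,2)] by (rule good_mono[OF K]) (use Suc.prems in auto)
    have 4: "good K (d - Suc (Suc v)) (\<lambda>x. (\<rho> ^^ m) f x - f x - of_nat m * (\<rho> f x - f x))"
      using 2[of m] by (rule good_mono[OF K]) auto
    have "good K (d - Suc (Suc v)) (\<lambda>x. inverse (of_nat m) *
        (((\<rho> ^^ m) f x - f x) - ((\<rho> ^^ m) f x - f x - of_nat m * (\<rho> f x - f x))))"
      by (intro good_scale good_diff K 3 4)
    moreover have "inverse (of_nat m) * (r - (r - of_nat m * s)) = s" for r s :: 'q
      using \<open>0 < m\<close> by simp
    ultimately show ?case by (simp only:)
  qed
  then show ?thesis using assms(7,8) by blast
qed

section \<open>Adjoining an element of finite order modulo \<open>K\<close>\<close>

locale finite_order_step = filtered_pair +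
  \<comment> \<open>\<open>q_type\<close> fixes the coefficient type of the functions, which appears
    in no other parameter.\<close>
  fixes K :: "'a set" and t :: 'a and m N :: nat and q_type :: "'q::field_char_0 itself"
  assumes K: "subgroup K G" and HK: "H \<subseteq> K" and t: "t \<in> normalizer K"
    and m: "0 < m" and t_pow_mem_iff: "t [^] (a::int) \<in> K \<longleftrightarrow> int m dvd a"
begin

definition u :: 'a where "u = t [^] m"

definition delta :: "('a \<Rightarrow> 'q) \<Rightarrow> 'a \<Rightarrow> 'q" where
  "delta f = (\<lambda>x. left_translate u f x - f x)"

text \<open>The binomial series of \<open>(1 + delta)\<^sup>q\<close>, where \<open>1 + delta\<close> is left translation by \<open>u\<close>.
  It is finite because \<open>delta\<close> lowers the degree.\<close>

definition binomial_op :: "'q \<Rightarrow> ('a \<Rightarrow> 'q) \<Rightarrow> 'a \<Rightarrow> 'q" where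
  "binomial_op q f = (\<lambda>x. \<Sum>j\<le>N. (q gchoose j) * (delta ^^ j) f x)"

text \<open>Moving \<open>t [^] a\<close> to the left of \<open>x\<close> conjugates
  \<open>x\<close>; the factor now on the left is then treated as the power of \<open>u\<close> with
  exponent a/m, and the binomial series is left translation by this fractional power.\<close>

definition T :: "int \<Rightarrow> ('a \<Rightarrow> 'q) \<Rightarrow> 'a \<Rightarrow> 'q" where
  "T a f = conj_translate (t [^] a) (binomial_op (of_int a / of_nat m) f)"

lemma K_closed: "x \<in> K \<Longrightarrow> x \<in> carrier G"
  using subgroup.mem_carrier[OF K] .

lemma t_closed [simp]: "t \<in> carrier G"
  using t by (rule normalizer_closed)

lemma t_pow: "t [^] (a::int) \<in> normalizer K"
  using subgroup_int_pow_closed[OF subgroup_normalizer t] .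

lemma t_pow_conj: "x \<in> K \<Longrightarrow> inv (t [^] (a::int)) \<otimes> x \<otimes> t [^] a \<in> K"
  using normalizer_conj_iff[OF t_pow] K_closed by blast

lemma u_mem: "u \<in> K"
  using t_pow_mem_iff[of "int m"] by (simp add: u_def int_pow_int)

lemma u_closed [simp]: "u \<in> carrier G"
  by (simp add: u_def)

lemma u_int_pow: "u [^] (b::int) = t [^] (int m * b)"
  by (simp add: u_def int_pow_int[symmetric] int_pow_pow)

lemma u_mult: "x \<in> K \<Longrightarrow> u \<otimes> x \<in> K"
  using subgroup.m_closed[OF K u_mem] .

lemma t_pow_u_commute: "t [^] (a::int) \<otimes> u = u \<otimes> t [^] a"
  by (simp add: u_def int_pow_int[symmetric] int_pow_mult[symmetric] add.commute)

lemma delta_good: "good K d f \<Longrightarrow> good K (d - 1) (delta f)"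
  using good_left_translate_diff[OF K HK _ u_mem, of d f 0] F_0 by (simp add: delta_def)

lemma delta_pow_good: "good K d f \<Longrightarrow> good K (d - j) ((delta ^^ j) f)"
proof (induction j)
  case (Suc j)
  then show ?case using delta_good[of "d - j"] by simp
qed simp

lemma delta_pow_cong:
  "(\<And>x. x \<in> K \<Longrightarrow> f x = g x) \<Longrightarrow> x \<in> K \<Longrightarrow> (delta ^^ j) f x = (delta ^^ j) g x"
  by (induction j arbitrary: x) (auto simp: delta_def left_translate_def u_mult)

lemma delta_pow_diff: "(delta ^^ j) (\<lambda>x. f x - g x) x = (delta ^^ j) f x - (delta ^^ j) g x"
  by (induction j arbitrary: x) (auto simp: delta_def left_translate_def)

lemma delta_pow_sum:
  "(delta ^^ j) (\<lambda>x. \<Sum>i\<in>I. r i * f i x) x = (\<Sum>i\<in>I. r i * (delta ^^ j) (f i) x)"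
  by (induction j arbitrary: x)
    (auto simp: delta_def left_translate_def right_diff_distrib sum_subtractf)

lemma delta_pow_right_translate:
  "\<lbrakk>x \<in> carrier G; y \<in> carrier G\<rbrakk>
    \<Longrightarrow> (delta ^^ j) (right_translate y f) x = (delta ^^ j) f (x \<otimes> y)"
  by (induction j arbitrary: x)
    (auto simp: delta_def left_translate_def right_translate_def m_assoc)

text \<open>\<open>u\<close> is a power of \<open>t\<close>, so it commutes with every
  \<open>t [^] a\<close>. This lets the two series in \<open>T_add\<close> be brought
  together.\<close>

lemma delta_pow_conj_translate:
  "x \<in> carrier G \<Longrightarrow>
    (delta ^^ j) (conj_translate (t [^] (a::int)) f) x = conj_translate (t [^] a) ((delta ^^ j) f) x"
proof (induction j arbitrary: x)
  case (Suc j)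
  have "u \<otimes> inv (t [^] a) = inv (t [^] a) \<otimes> u"
    using t_pow_u_commute[of "- a"] by (simp add: int_pow_neg)
  then have "inv (t [^] a) \<otimes> (u \<otimes> x) \<otimes> t [^] a = u \<otimes> (inv (t [^] a) \<otimes> x \<otimes> t [^] a)"
    using Suc.prems by (simp add: m_assoc[symmetric])
  then show ?case using Suc by (simp add: delta_def left_translate_def conj_translate_def)
qed simp

lemma binomial_op_good: "good K d f \<Longrightarrow> good K d (binomial_op q f)"
  unfolding binomial_op_def
  by (intro good_sum good_scale K good_mono[OF K delta_pow_good]) auto

lemma binomial_op_diff_good:
  assumes "good K d f"
  shows "good K (d - 1) (\<lambda>x. binomial_op q f x - f x)"
proof -
  have "binomial_op q f x - f x = (\<Sum>j\<in>{1..N}. (q gchoose j) * (delta ^^ j) f x)" for x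
  proof -
    have "{..N} = insert 0 {1..N}" by auto
    then show ?thesis by (simp add: binomial_op_def)
  qed
  moreover have "good K (d - 1) (\<lambda>x. \<Sum>j\<in>{1..N}. (q gchoose j) * (delta ^^ j) f x)"
    using assms by (intro good_sum good_scale K good_mono[OF K delta_pow_good]) auto
  ultimately show ?thesis by simp
qed

lemma delta_pow_eq_0: "\<lbrakk>good K N f; N \<le> j; x \<in> K\<rbrakk> \<Longrightarrow> (delta ^^ j) f x = 0"
  using delta_pow_good[of N f j] good_0_iff[OF K HK] by auto

text \<open>This is the exponent law for powers of 1 + \<open>delta\<close>, by Vandermonde's
  convolution. Cutting the series off is harmless, since the powers of \<open>delta\<close> from
  \<open>N\<close> on send \<open>f\<close> to 0 on \<open>K\<close>.\<close>

lemma binomial_op_add: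
  assumes f: "good K N f" and x: "x \<in> K"
  shows "binomial_op (p + q) f x = binomial_op p (binomial_op q f) x"
proof -
  let ?A = "\<lambda>k. (delta ^^ k) f x"
  have "binomial_op p (binomial_op q f) x
      = (\<Sum>i\<le>N. \<Sum>j\<le>N. (p gchoose i) * ((q gchoose j) * ?A (i + j)))"
    by (simp add: binomial_op_def delta_pow_sum funpow_add sum_distrib_left)
  also have "\<dots> = (\<Sum>(i, j)\<in>{..N} \<times> {..N}. (p gchoose i) * ((q gchoose j) * ?A (i + j)))"
    by (simp add: sum.cartesian_product)
  also have "\<dots> = (\<Sum>(i, j)\<in>{(i, j). i + j \<le> N}. (p gchoose i) * ((q gchoose j) * ?A (i + j)))"
    by (intro sum.mono_neutral_right) (auto intro!: delta_pow_eq_0[OF f _ x])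
  also have "\<dots> = (\<Sum>k\<le>N. \<Sum>i\<le>k. (p gchoose i) * ((q gchoose (k - i)) * ?A (i + (k - i))))"
    by (rule sum.triangle_reindex_eq)
  also have "\<dots> = (\<Sum>k\<le>N. ((p + q) gchoose k) * ?A k)"
    by (intro sum.cong refl)
      (simp add: gbinomial_Vandermonde[symmetric] sum_distrib_right atLeast0AtMost mult.assoc)
  finally show ?thesis by (simp add: binomial_op_def)
qed

lemma binomial_op_cong:
  "(\<And>x. x \<in> K \<Longrightarrow> f x = g x) \<Longrightarrow> x \<in> K \<Longrightarrow> binomial_op q f x = binomial_op q g x"
  using delta_pow_cong[of f g x] by (simp add: binomial_op_def)

lemma binomial_op_0: "binomial_op 0 f x = f x"
proof -
  have "{..N} = insert 0 {1..N}" by auto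
  then show ?thesis by (simp add: binomial_op_def gbinomial_0_left)
qed

lemma binomial_op_1:
  assumes f: "good K N f" and x: "x \<in> K"
  shows "binomial_op 1 f x = f (u \<otimes> x)"
\<comment> \<open>For \<open>N = 0\<close> the series stops before its \<open>delta\<close> term,
  but then \<open>f\<close> vanishes on \<open>K\<close>.\<close>
proof (cases "N = 0")
  case True
  then have "f x = 0" "f (u \<otimes> x) = 0"
    using delta_pow_eq_0[OF f _ x, of 0] delta_pow_eq_0[OF f _ u_mult[OF x], of 0] by auto
  moreover have "{..N} = {0}" using True by auto
  ultimately show ?thesis by (simp only: binomial_op_def) simp
next
  case False
  have "(1::'q) gchoose j = of_nat (1 choose j)" for j
    using binomial_gbinomial[of 1 j, where 'a = 'q] by simp
  then have "binomial_op 1 f x = (\<Sum>j\<in>{0,1}. of_nat (1 choose j) * (delta ^^ j) f x)"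
    unfolding binomial_op_def using False by (intro sum.mono_neutral_cong_right) auto
  then show ?thesis by (simp add: delta_def left_translate_def)
qed

lemma binomial_op_of_int:
  assumes f: "good K N f" and x: "x \<in> K"
  shows "binomial_op (of_int b) f x = f (u [^] b \<otimes> x)"
  using x
proof (induction b arbitrary: x rule: int_induct[where k = 0])
  case base
  then show ?case by (simp add: binomial_op_0 K_closed)
next
  case (step1 i)
  have "binomial_op (of_int (i + 1)) f x = binomial_op 1 (binomial_op (of_int i) f) x"
    using binomial_op_add[OF f step1.prems, of 1 "of_int i"] by (simp add: add.commute)
  also have "\<dots> = f (u [^] i \<otimes> (u \<otimes> x))"
    using binomial_op_1[OF binomial_op_good[OF f] step1.prems] step1.IH[OF u_mult[OF step1.prems]] by simp
  finally show ?case using K_closed[OF step1.prems] by (simp add: int_pow_mult m_assoc)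
next
  case (step2 i)
  \<comment> \<open>The downward step is evaluated at a point from which one translation by
    \<open>u\<close> leads back to \<open>x\<close>.\<close>
  let ?y = "inv u \<otimes> x"
  have y: "?y \<in> K" using subgroup.m_closed[OF K subgroup.m_inv_closed[OF K u_mem] step2.prems] .
  have "u \<otimes> ?y = x" using K_closed[OF step2.prems] by (simp add: inv_mult_cancel)
  then have "binomial_op (of_int (i - 1)) f x = binomial_op 1 (binomial_op (of_int (i - 1)) f) ?y"
    using binomial_op_1[OF binomial_op_good[OF f] y] by simp
  also have "\<dots> = binomial_op (of_int i) f ?y"
    using binomial_op_add[OF f y, of 1 "of_int (i - 1)"] by simp
  also have "\<dots> = f (u [^] i \<otimes> ?y)" using step2.IH[OF y] .
  finally show ?case using K_closed[OF step2.prems] by (simp add: int_pow_diff m_assoc)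
qed

lemma T_cong: "\<lbrakk>\<And>x. x \<in> K \<Longrightarrow> f x = g x; x \<in> K\<rbrakk> \<Longrightarrow> T a f x = T a g x"
  unfolding T_def conj_translate_def using t_pow_conj by (intro binomial_op_cong) auto

lemma T_diff: "T a (\<lambda>x. f x - g x) x = T a f x - T a g x"
  by (simp add: T_def conj_translate_def binomial_op_def delta_pow_diff right_diff_distrib sum_subtractf)

lemma T_good: "good K d f \<Longrightarrow> good K d (T a f)"
  unfolding T_def using good_conj_translate[OF K HK binomial_op_good t_pow] .

lemma T_add:
  assumes f: "good K N f" and x: "x \<in> K"
  shows "T (a + b) f x = T a (T b f) x"
proof -
  let ?p = "of_int a / of_nat m" and ?q = "of_int b / of_nat m" and ?y = "inv (t [^] a) \<otimes> x \<otimes> t [^] a"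
  let ?z = "inv (t [^] b) \<otimes> ?y \<otimes> t [^] b"
  have y: "?y \<in> K" using t_pow_conj[OF x] .
  have "T a (T b f) x = binomial_op ?p (conj_translate (t [^] b) (binomial_op ?q f)) ?y"
    by (simp add: T_def conj_translate_def)
  also have "\<dots> = binomial_op ?p (binomial_op ?q f) ?z"
    using delta_pow_conj_translate[OF K_closed[OF y], of _ b "binomial_op ?q f"]
    by (simp add: binomial_op_def[of ?p] conj_translate_def)
  also have "\<dots> = binomial_op (?p + ?q) f ?z"
    using binomial_op_add[OF f t_pow_conj[OF y]] by simp
  also have "\<dots> = T (a + b) f x"
    using K_closed[OF x]
    by (simp add: T_def conj_translate_def int_pow_mult word_simps add_divide_distrib)
  finally show ?thesis by simp
qed

lemma T_right_translate:
  assumes "y \<in> K" "x \<in> K"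
  shows "T a (right_translate y f) x = T a f (x \<otimes> (t [^] a \<otimes> y \<otimes> inv (t [^] a)))"
proof -
  have c: "x \<in> carrier G" "y \<in> carrier G" using assms K_closed by auto
  have "T a (right_translate y f) x
      = binomial_op (of_int a / of_nat m) f (inv (t [^] a) \<otimes> x \<otimes> t [^] a \<otimes> y)"
    using c by (simp add: T_def conj_translate_def binomial_op_def delta_pow_right_translate)
  moreover have "inv (t [^] a) \<otimes> (x \<otimes> (t [^] a \<otimes> y \<otimes> inv (t [^] a))) \<otimes> t [^] a
      = inv (t [^] a) \<otimes> x \<otimes> t [^] a \<otimes> y"
    using c by (simp add: m_assoc)
  ultimately show ?thesis by (simp add: T_def conj_translate_def)
qed

text \<open>Here \<open>m\<close> divides \<open>a\<close>, so the exponent a/m is an integer and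
  the series is the genuine left translation by a power of \<open>u\<close>, which is
  \<open>t [^] a\<close>.\<close>

lemma T_mem:
  assumes "t [^] a \<in> K" and f: "good K N f" and x: "x \<in> K"
  shows "T a f x = f (x \<otimes> t [^] a)"
proof -
  obtain b where b: "a = int m * b" using assms(1) t_pow_mem_iff by blast
  then have "of_int a / of_nat m = (of_int b :: 'q)" using m by simp
  then have "T a f x = f (u [^] b \<otimes> (inv (t [^] a) \<otimes> x \<otimes> t [^] a))"
    using binomial_op_of_int[OF f t_pow_conj[OF x]] by (simp add: T_def conj_translate_def)
  then show ?thesis
    using K_closed[OF x] by (simp add: u_int_pow b[symmetric] m_assoc inv_mult_cancel)
qed

text \<open>The iterated operator stands for right translation of the extension by
  \<open>y \<otimes> t [^] a\<close>, so its iterates follow the powers of that element. At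
  \<open>i = m\<close> the power of \<open>t\<close> is back in \<open>K\<close>.\<close>

lemma T_power:
  assumes f: "good K N f" and y: "y \<in> K"
  shows "\<exists>z\<in>K. (y \<otimes> t [^] a) [^] i = z \<otimes> t [^] (int i * a) \<and>
    (\<forall>x\<in>K. ((\<lambda>f. right_translate y (T a f)) ^^ i) f x = T (int i * a) f (x \<otimes> z))"
proof (induction i)
  case 0
  show ?case
    using T_mem[of 0 f] subgroup.one_closed[OF K] f K_closed by (intro bexI[of _ \<one>]) auto
next
  case (Suc i)
  let ?\<rho> = "\<lambda>f. right_translate y (T a f)"
  obtain z where z: "z \<in> K" "(y \<otimes> t [^] a) [^] i = z \<otimes> t [^] (int i * a)"
    "\<And>x. x \<in> K \<Longrightarrow> (?\<rho> ^^ i) f x = T (int i * a) f (x \<otimes> z)" using Suc by blast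
  let ?z = "y \<otimes> (t [^] a \<otimes> z \<otimes> inv (t [^] a))"
  have conj: "t [^] a \<otimes> z \<otimes> inv (t [^] a) \<in> K"
    using normalizer_conj_iff'[OF t_pow] z(1) K_closed by blast
  have c: "y \<in> carrier G" "z \<in> carrier G" using y z K_closed by auto
  have e: "int (Suc i) * a = a + int i * a" by (simp add: algebra_simps)
  have "(y \<otimes> t [^] a) [^] Suc i = (y \<otimes> t [^] a) \<otimes> (z \<otimes> t [^] (int i * a))"
    using c z(2) by (simp only: nat_pow_Suc2 m_closed int_pow_closed t_closed)
  also have "\<dots> = ?z \<otimes> t [^] (int (Suc i) * a)"
    unfolding e using c by (simp add: m_assoc int_pow_mult inv_mult_cancel)
  finally have 1: "(y \<otimes> t [^] a) [^] Suc i = ?z \<otimes> t [^] (int (Suc i) * a)" .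
  have 2: "(?\<rho> ^^ Suc i) f x = T (int (Suc i) * a) f (x \<otimes> ?z)" if x: "x \<in> K" for x
  proof -
    have xy: "x \<otimes> y \<in> K" using subgroup.m_closed[OF K x y] .
    have xz: "x \<otimes> ?z \<in> K" using subgroup.m_closed[OF K x subgroup.m_closed[OF K y conj]] .
    have "(?\<rho> ^^ Suc i) f x = T a ((?\<rho> ^^ i) f) (x \<otimes> y)" by (simp add: right_translate_def)
    also have "\<dots> = T a (right_translate z (T (int i * a) f)) (x \<otimes> y)"
      using z(3) xy by (intro T_cong) (auto simp: right_translate_def)
    also have "\<dots> = T a (T (int i * a) f) (x \<otimes> ?z)"
      using T_right_translate[OF z(1) xy] c K_closed[OF x] by (simp add: m_assoc)
    also have "\<dots> = T (int (Suc i) * a) f (x \<otimes> ?z)" unfolding e using T_add[OF f xz] by simp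
    finally show ?thesis .
  qed
  show ?case using 1 2 subgroup.m_closed[OF K y conj] by blast
qed

text \<open>Neither \<open>y\<close> nor \<open>t [^] a\<close> has to lie in \<open>F w\<close>, so
  separate estimates give a drop of 1 only. The \<open>m\<close>-th power of their product lies in
  \<open>K\<close> and in \<open>F w\<close>; there the operator is an actual translation with the
  full drop, which \<open>lower_if_power_lower\<close> hands down.\<close>

lemma T_lower:
  assumes "d \<le> N" and f: "good K d f" and y: "y \<in> K" and w: "y \<otimes> t [^] a \<in> F w"
  shows "good K (d - Suc w) (\<lambda>x. right_translate y (T a f) x - f x)"
proof (rule lower_if_power_lower[OF K m, where \<rho> = "\<lambda>f. right_translate y (T a f)" and N = N])
  show "right_translate y (T a (\<lambda>x. f x - g x)) x = right_translate y (T a f) x - right_translate y (T a g) x"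
    for f g x by (simp add: right_translate_def T_diff)
  show "good K d (right_translate y (T a f))" if "good K d f" for d f
    using good_right_translate[OF K HK T_good[OF that] y] .
  show "good K (d - 1) (\<lambda>x. right_translate y (T a f) x - f x)" if f: "good K d f" for d f
  proof -
    let ?S = "binomial_op (of_int a / of_nat m) f"
    \<comment> \<open>The difference is telescoped through \<open>T a f\<close> and the series
      \<open>?S\<close>; each of the three stages lowers the degree by one.\<close>
    have 1: "good K (d - 1) (\<lambda>x. right_translate y (T a f) x - T a f x)"
      using good_right_translate_diff[OF K HK T_good[OF f] y, of 0] F_0 K_closed[OF y] by simp
    have 2: "good K (d - 1) (\<lambda>x. T a f x - ?S x)"
      unfolding T_def
      using good_conj_translate_diff[OF K HK binomial_op_good[OF f] t_pow, of a 0] F_0 by simp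
    from good_add[OF K good_add[OF K 1 2] binomial_op_diff_good[OF f, of "of_int a / of_nat m"]]
    show ?thesis by simp
  qed
  show "good K (d - Suc w) (\<lambda>x. ((\<lambda>f. right_translate y (T a f)) ^^ m) f x - f x)"
    if d: "d \<le> N" and f: "good K d f" for d f
  proof -
    have fN: "good K N f" using good_mono[OF K f d] .
    obtain z where z: "z \<in> K" "(y \<otimes> t [^] a) [^] m = z \<otimes> t [^] (int m * a)"
      "\<And>x. x \<in> K \<Longrightarrow> ((\<lambda>f. right_translate y (T a f)) ^^ m) f x = T (int m * a) f (x \<otimes> z)"
      using T_power[OF fN y, of a m] by blast
    let ?g = "z \<otimes> t [^] (int m * a)"
    have tm: "t [^] (int m * a) \<in> K" by (simp add: t_pow_mem_iff)
    have g: "?g \<in> K" using subgroup.m_closed[OF K z(1) tm] .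
    have gw: "?g \<in> F w"
      using subgroup_int_pow_closed[OF F_subgroup w, of "int m"] z(2) by (simp add: int_pow_int)
    show ?thesis
    proof (rule good_cong[OF K HK _ good_right_translate_diff[OF K HK f g gw]])
      fix x assume x: "x \<in> K"
      show "right_translate ?g f x - f x = ((\<lambda>f. right_translate y (T a f)) ^^ m) f x - f x"
        using z(3)[OF x] T_mem[OF tm fN subgroup.m_closed[OF K x z(1)]] K_closed[OF x] K_closed[OF z(1)]
        by (simp add: right_translate_def m_assoc)
    qed
  qed
qed (use assms in auto)

lemma extension_step: "extension_step G F c H K t N T"
  by (intro extension_step.intro extension_step_axioms.intro filtered_pair_axioms K HK t
      T_cong T_diff T_good T_add T_right_translate T_mem T_lower)

end

section \<open>Choosing the element to adjoin, and Zorn's lemma\<close>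

context group
begin

text \<open>If \<open>t\<close> has infinite order modulo \<open>K\<close>, this shows the same for
  \<open>y \<otimes> t [^] a\<close> with \<open>a \<noteq> 0\<close>, which thus competes with
  \<open>t\<close> for the maximal weight.\<close>

lemma mult_pow_mod_subgroup:
  assumes K: "subgroup K G" and t: "t \<in> normalizer K" and y: "y \<in> K"
  shows "\<exists>z\<in>K. (y \<otimes> t [^] (a::int)) [^] (i::nat) = z \<otimes> t [^] (int i * a)"
proof (induction i)
  case 0
  show ?case using subgroup.one_closed[OF K] by (intro bexI[of _ \<one>]) auto
next
  case (Suc i)
  then obtain z where z: "z \<in> K" "(y \<otimes> t [^] a) [^] i = z \<otimes> t [^] (int i * a)" by blast
  let ?c = "t [^] a \<otimes> z \<otimes> inv (t [^] a)"
  have c: "y \<in> carrier G" "z \<in> carrier G" "t \<in> carrier G"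
    using y z(1) subgroup.mem_carrier[OF K] normalizer_closed[OF t] by auto
  have "?c \<in> K"
    using normalizer_conj_iff'[OF subgroup_int_pow_closed[OF subgroup_normalizer t] c(2)] z(1) by simp
  then have "y \<otimes> ?c \<in> K" using subgroup.m_closed[OF K y] by blast
  moreover have "(y \<otimes> t [^] a) [^] Suc i = (y \<otimes> t [^] a) \<otimes> (z \<otimes> t [^] (int i * a))"
    using c z(2) by (simp only: nat_pow_Suc2 m_closed int_pow_closed)
  moreover have "(y \<otimes> t [^] a) \<otimes> (z \<otimes> t [^] (int i * a)) = (y \<otimes> ?c) \<otimes> t [^] (int (Suc i) * a)"
    using c by (simp add: m_assoc int_pow_mult inv_mult_cancel distrib_right)
  ultimately show ?case by metis
qed

end

context filtered_pair
begin

text \<open>The last term of the filtration not contained in \<open>K\<close> normalizes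
  \<open>K\<close>, because its commutators with the group lie in the next term and hence in
  \<open>K\<close>.\<close>

lemma exists_normalizing_element:
  assumes K: "subgroup K G" and "K \<noteq> carrier G"
  shows "\<exists>t\<in>normalizer K. t \<notin> K"
proof -
  have "F c \<subseteq> K" using F_end subgroup.one_closed[OF K] by simp
  define i where "i = (LEAST i. F i \<subseteq> K)"
  have i: "F i \<subseteq> K" unfolding i_def using \<open>F c \<subseteq> K\<close> by (rule LeastI)
  have "\<not> F 0 \<subseteq> K" using F_0 assms(2) subgroup.subset[OF K] by auto
  then obtain j where j: "i = Suc j" using i by (cases i) auto
  then have "\<not> F j \<subseteq> K" using not_less_Least[of j "\<lambda>i. F i \<subseteq> K"] by (simp add: i_def)
  then obtain t where t: "t \<in> F j" "t \<notin> K" by auto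
  have tc: "t \<in> carrier G" using F_closed[OF t(1)] .
  have comm: "commutator x y \<in> K" if "x \<in> carrier G" "y \<in> F j" for x y
    using F_commutator[of x 0 y j] F_0 that i j by auto
  \<comment> \<open>Stated for all \<open>s\<close> in \<open>F j\<close>, since the converse
    direction applies it to \<open>inv t\<close>.\<close>
  have fwd: "inv s \<otimes> x \<otimes> s \<in> K" if x: "x \<in> K" and s: "s \<in> F j" for x s
  proof -
    have xc: "x \<in> carrier G" "s \<in> carrier G" using subgroup.mem_carrier[OF K x] F_closed[OF s] by auto
    have "x \<otimes> commutator (inv x) (inv s) \<in> K"
      using xc subgroup.m_inv_closed[OF F_subgroup s] by (intro subgroup.m_closed[OF K x] comm) auto
    then show ?thesis using xc by (simp add: commutator_def word_simps)
  qed
  have bwd: "x \<in> K" if "inv t \<otimes> x \<otimes> t \<in> K" "x \<in> carrier G" for x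
    using fwd[OF that(1) subgroup.m_inv_closed[OF F_subgroup t(1)]] conj_conj_inv[OF tc that(2)] tc by simp
  have "\<forall>x\<in>carrier G. inv t \<otimes> x \<otimes> t \<in> K \<longleftrightarrow> x \<in> K" using fwd[OF _ t(1)] bwd by blast
  then have "t \<in> normalizer K" unfolding normalizer_def using tc by blast
  then show ?thesis using t(2) by blast
qed

lemma exists_extension_step:
  fixes N :: nat
  assumes K: "subgroup K G" and HK: "H \<subseteq> K" and "K \<noteq> carrier G"
  shows "\<exists>t T. t \<notin> K \<and> extension_step G F c H K t N (T :: int \<Rightarrow> ('a \<Rightarrow> 'q::field_char_0) \<Rightarrow> 'a \<Rightarrow> 'q)"
proof (cases "\<exists>t\<in>normalizer K. \<forall>a::int. t [^] a \<in> K \<longrightarrow> a = 0")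
  case True
  \<comment> \<open>The maximum is taken over all normalizing elements of infinite order modulo
    \<open>K\<close>, which include every \<open>y \<otimes> t [^] a\<close> with
    \<open>a \<noteq> 0\<close>. It exists because the filtration ends.\<close>
  define W where "W = {v. \<exists>t\<in>normalizer K. t \<in> F v \<and> (\<forall>a::int. t [^] a \<in> K \<longrightarrow> a = 0)}"
  have bound: "v \<le> c" if v: "v \<in> W" for v
  proof (rule ccontr)
    assume "\<not> v \<le> c"
    from v obtain t where t: "t \<in> F v" "\<forall>a::int. t [^] a \<in> K \<longrightarrow> a = 0" by (auto simp: W_def)
    have "t = \<one>" using F_eq_one[of v t] t(1) \<open>\<not> v \<le> c\<close> by simp
    then have "t [^] (1::int) \<in> K" using subgroup.one_closed[OF K] by simp
    then show False using t(2) by fastforce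
  qed
  then have fin: "finite W" by (meson atMost_iff finite_atMost finite_subset subsetI)
  have ne: "W \<noteq> {}" using True F_0 normalizer_closed unfolding W_def by blast
  define v where "v = Max W"
  have "v \<in> W" using Max_in[OF fin ne] by (simp add: v_def)
  then obtain t where t: "t \<in> normalizer K" "t \<in> F v"
    and inf: "\<And>a::int. t [^] a \<in> K \<Longrightarrow> a = 0" by (auto simp: W_def)
  have tc: "t \<in> carrier G" using t(1) by (rule normalizer_closed)
  have max: "w \<le> v" if a: "a \<noteq> 0" and y: "y \<in> K" "y \<otimes> t [^] (a::int) \<in> F w" for a y w
  proof -
    let ?s = "y \<otimes> t [^] a"
    have s: "?s \<in> normalizer K"
      using y(1) t(1) subgroup_subset_normalizer[OF K] subgroup_int_pow_closed[OF subgroup_normalizer]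
      by (intro subgroup.m_closed[OF subgroup_normalizer]) auto
    have yc: "y \<in> carrier G" using subgroup.mem_carrier[OF K y(1)] .
    have nat: "i = 0" if i: "?s [^] i \<in> K" for i :: nat
    proof -
      obtain z where z: "z \<in> K" "?s [^] i = z \<otimes> t [^] (int i * a)"
        using mult_pow_mod_subgroup[OF K t(1) y(1)] by blast
      have "inv z \<otimes> (z \<otimes> t [^] (int i * a)) \<in> K"
        using subgroup.m_closed[OF K subgroup.m_inv_closed[OF K z(1)] i] z(2) by simp
      then have "t [^] (int i * a) \<in> K"
        using subgroup.mem_carrier[OF K z(1)] tc by (simp add: inv_mult_cancel)
      then show "i = 0" using inf a by fastforce
    qed
    have "b = 0" if b: "?s [^] b \<in> K" for b :: int
    proof (cases "0 \<le> b")
      case True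
      then show ?thesis using nat[of "nat b"] b int_pow_int[of G ?s "nat b"] by simp
    next
      case False
      then have "?s [^] (nat (- b)) = inv (?s [^] b)"
        using int_pow_int[of G ?s "nat (- b)"] int_pow_neg[of ?s b] yc tc by simp
      then show ?thesis using nat[of "nat (- b)"] subgroup.m_inv_closed[OF K b] False by simp
    qed
    then have "w \<in> W" unfolding W_def using s y(2) by blast
    then show "w \<le> v" unfolding v_def using fin by (rule Max_ge[rotated])
  qed
  have "t \<notin> K" using inf[of 1] tc by auto
  moreover have "extension_step G F c H K t N (\<lambda>a. conj_translate (t [^] a) :: ('a \<Rightarrow> 'q) \<Rightarrow> 'a \<Rightarrow> 'q)"
    using K HK t inf max by (rule extension_step_infinite_order) simp_all
  ultimately show ?thesis by blast
next
  case False
  obtain t where t: "t \<in> normalizer K" "t \<notin> K" using exists_normalizing_element[OF K assms(3)] by blast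
  have tc: "t \<in> carrier G" using t(1) by (rule normalizer_closed)
  obtain a :: int where a: "t [^] a \<in> K" "a \<noteq> 0" using False t(1) by blast
  have "t [^] \<bar>a\<bar> \<in> K"
    using a(1) subgroup.m_inv_closed[OF K a(1)] int_pow_neg[OF tc, of a] by (simp add: abs_if)
  then have ex: "0 < nat \<bar>a\<bar> \<and> t [^] (nat \<bar>a\<bar>) \<in> K"
    using a(2) int_pow_int[of G t "nat \<bar>a\<bar>"] by simp
  define m where "m = (LEAST i::nat. 0 < i \<and> t [^] i \<in> K)"
  have m: "0 < m" "t [^] m \<in> K" using LeastI[of "\<lambda>i. 0 < i \<and> t [^] i \<in> K", OF ex] by (simp_all add: m_def)
  have mult: "t [^] (int m * b) \<in> K" for b
    using subgroup_int_pow_closed[OF K m(2), of b] tc by (simp add: int_pow_int[symmetric] int_pow_pow)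
  have iff: "t [^] b \<in> K \<longleftrightarrow> int m dvd b" for b :: int
  proof
    assume b: "t [^] b \<in> K"
    let ?r = "nat (b mod int m)"
    have "t [^] (b mod int m) = t [^] b \<otimes> inv (t [^] (int m * (b div int m)))"
      using int_pow_diff[OF tc, of b "int m * (b div int m)"] by (simp add: minus_mult_div_eq_mod)
    then have "t [^] ?r \<in> K"
      using subgroup.m_closed[OF K b subgroup.m_inv_closed[OF K mult]] m(1)
        int_pow_int[of G t ?r] by simp
    moreover have "?r < m" using m(1) by (simp add: nat_less_iff)
    ultimately have "?r = 0" using not_less_Least[of ?r "\<lambda>i. 0 < i \<and> t [^] i \<in> K"] by (auto simp: m_def)
    then have "b mod int m \<le> 0" by simp
    moreover have "0 \<le> b mod int m" using m(1) by simp
    ultimately show "int m dvd b" by (simp only: dvd_eq_mod_eq_0)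
  next
    assume "int m dvd b"
    then show "t [^] b \<in> K" using mult by (auto elim!: dvdE)
  qed
  have "finite_order_step G F c H K t m"
    using K HK t(1) m(1) iff
    by (intro finite_order_step.intro finite_order_step_axioms.intro filtered_pair_axioms)
  from finite_order_step.extension_step[OF this] show ?thesis using t(2) by blast
qed

lemma exists_proper_extension:
  fixes f :: "'a \<Rightarrow> 'q::field_char_0"
  assumes K: "subgroup K G" "H \<subseteq> K" "K \<noteq> carrier G" and f: "good K N f"
  shows "\<exists>K' f'. subgroup K' G \<and> K \<subset> K' \<and> good K' N f' \<and> (\<forall>x\<in>K. f' x = f x)"
proof -
  obtain t and T :: "int \<Rightarrow> ('a \<Rightarrow> 'q) \<Rightarrow> 'a \<Rightarrow> 'q" where t: "t \<notin> K" and "extension_step G F c H K t N T"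
    using exists_extension_step[OF K] by blast
  then interpret S: extension_step G F c H K t N T by simp
  have "t \<in> S.adjoined"
    using S.adjoinedI[OF subgroup.one_closed[OF K(1)], of 1] by simp
  then show ?thesis
    using S.subgroup_adjoined S.subset_adjoined S.good_ext[OF f] S.ext_eq_on[OF f] t by blast
qed

theorem extension_exists:
  fixes f\<^sub>0 :: "'a \<Rightarrow> 'q::field_char_0"
  assumes K\<^sub>0: "subgroup K\<^sub>0 G" "H \<subseteq> K\<^sub>0" and f\<^sub>0: "good K\<^sub>0 N f\<^sub>0"
  shows "\<exists>f. good (carrier G) N f \<and> (\<forall>x\<in>K\<^sub>0. f x = f\<^sub>0 x)"
proof -
  \<comment> \<open>A function on a subgroup is encoded by its graph \<open>S\<close>: extension
    becomes inclusion, and values off \<open>K\<close> do not count.\<close>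
  define P where "P S K f \<longleftrightarrow> S = (\<lambda>x. (x, f x)) ` K \<and> subgroup K G \<and> K\<^sub>0 \<subseteq> K \<and>
    good K N f \<and> (\<forall>x\<in>K\<^sub>0. f x = f\<^sub>0 x)" for S K and f :: "'a \<Rightarrow> 'q"
  define A where "A = {S. \<exists>K f. P S K f}"
  have "\<exists>M\<in>A. \<forall>X\<in>A. M \<subseteq> X \<longrightarrow> X = M"
  proof (rule subset_Zorn_nonempty)
    show "A \<noteq> {}" using K\<^sub>0 f\<^sub>0 unfolding A_def P_def by blast
  next
    fix C assume "C \<noteq> {}" and chain: "subset.chain A C"
    then have CA: "C \<subseteq> A" and lin: "\<And>S S'. \<lbrakk>S \<in> C; S' \<in> C\<rbrakk> \<Longrightarrow> S \<subseteq> S' \<or> S' \<subseteq> S"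
      unfolding subset_chain_def by auto
    define f where "f x = (THE y. (x, y) \<in> \<Union>C)" for x
    let ?\<K> = "(`) fst ` C"
    have part: "S = (\<lambda>x. (x, f x)) ` (fst ` S) \<and> subgroup (fst ` S) G \<and> K\<^sub>0 \<subseteq> fst ` S \<and>
        good (fst ` S) N f \<and> (\<forall>x\<in>K\<^sub>0. f x = f\<^sub>0 x)" if S: "S \<in> C" for S
    proof -
      obtain K g where P: "P S K g" using S CA by (auto simp: A_def)
      then have dom: "fst ` S = K" by (auto simp: P_def image_image)
      have eq: "f x = g x" if x: "x \<in> K" for x
        unfolding f_def
      proof (rule the_equality)
        show "(x, g x) \<in> \<Union>C" using P x S by (auto simp: P_def)
      next
        fix y assume "(x, y) \<in> \<Union>C"
        then obtain S' where S': "S' \<in> C" "(x, y) \<in> S'" by blast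
        obtain K' g' where P': "P S' K' g'" using S'(1) CA by (auto simp: A_def)
        have "(x, g x) \<in> S" using P x by (auto simp: P_def)
        from lin[OF S S'(1)] show "y = g x"
          using \<open>(x, g x) \<in> S\<close> S'(2) P P' by (auto simp: P_def)
      qed
      have "good K N f"
        using P K\<^sub>0(2) eq by (intro good_cong[of K g f]) (auto simp: P_def)
      then show ?thesis using P eq unfolding dom by (auto simp: P_def)
    qed
    obtain S\<^sub>0 where S\<^sub>0: "S\<^sub>0 \<in> C" using \<open>C \<noteq> {}\<close> by auto
    have part_subgroup: "subgroup L G" and part_good: "good L N f" if L: "L \<in> ?\<K>" for L
    proof -
      obtain S where "S \<in> C" "L = fst ` S" using L by blast
      then show "subgroup L G" "good L N f" using part by simp_all
    qed
    have lin': "K \<subseteq> L \<or> L \<subseteq> K" if KL: "K \<in> ?\<K>" "L \<in> ?\<K>" for K L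
    proof -
      obtain S S' where S: "S \<in> C" "S' \<in> C" "K = fst ` S" "L = fst ` S'" using KL by blast
      show ?thesis unfolding S(3,4) using lin[OF S(1,2)] image_mono by blast
    qed
    have K\<^sub>0_sub: "K\<^sub>0 \<subseteq> \<Union>?\<K>" using part[OF S\<^sub>0] S\<^sub>0 by blast
    have f_K\<^sub>0: "\<forall>x\<in>K\<^sub>0. f x = f\<^sub>0 x" using part[OF S\<^sub>0] by simp
    have graph: "\<Union>C = (\<lambda>x. (x, f x)) ` \<Union>?\<K>"
    proof -
      have "(\<Union>S\<in>C. S) = (\<Union>S\<in>C. (\<lambda>x. (x, f x)) ` (fst ` S))"
        by (rule SUP_cong[OF refl]) (use part in simp)
      then show ?thesis by (simp add: image_Union)
    qed
    have sub: "subgroup (\<Union>?\<K>) G"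
    proof (rule subgroupI)
      show "\<Union>?\<K> \<subseteq> carrier G" by (rule Sup_least) (rule subgroup.subset[OF part_subgroup])
      show "\<Union>?\<K> \<noteq> {}" using K\<^sub>0_sub subgroup.one_closed[OF K\<^sub>0(1)] by blast
    next
      fix x assume "x \<in> \<Union>?\<K>"
      then obtain L where "L \<in> ?\<K>" "x \<in> L" by (rule UnionE)
      then show "inv x \<in> \<Union>?\<K>" using subgroup.m_inv_closed[OF part_subgroup] by (intro UnionI)
    next
      fix x y assume "x \<in> \<Union>?\<K>" "y \<in> \<Union>?\<K>"
      then obtain K L where KL: "K \<in> ?\<K>" "x \<in> K" "L \<in> ?\<K>" "y \<in> L" by (elim UnionE)
      then obtain M where "M \<in> ?\<K>" "x \<in> M" "y \<in> M" using lin'[OF KL(1,3)] by blast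
      then show "x \<otimes> y \<in> \<Union>?\<K>" using subgroup.m_closed[OF part_subgroup] by (intro UnionI)
    qed
    have "poly (\<Union>?\<K>) N f"
      by (rule poly_Union[OF lin']) (use part_good good_def in blast)+
    moreover have "affine (\<Union>?\<K>) f"
      using part_good unfolding good_def affine_def by (metis UnionE)
    ultimately have "P (\<Union>C) (\<Union>?\<K>) f"
      unfolding P_def good_def using sub K\<^sub>0_sub f_K\<^sub>0 graph by blast
    then show "\<Union>C \<in> A" unfolding A_def by blast
  qed
  then obtain M where "M \<in> A" and max: "\<And>X. \<lbrakk>X \<in> A; M \<subseteq> X\<rbrakk> \<Longrightarrow> X = M" by blast
  then obtain K f where P: "P M K f" by (auto simp: A_def)
  have "K = carrier G"
  proof (rule ccontr)
    assume "K \<noteq> carrier G"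
    then obtain K' f' where K': "subgroup K' G" "K \<subset> K'" "good K' N f'" "\<forall>x\<in>K. f' x = f x"
      using exists_proper_extension[of K N f] P K\<^sub>0(2) by (auto simp: P_def)
    have "P ((\<lambda>x. (x, f' x)) ` K') K' f'" using K' P by (auto simp: P_def)
    moreover have "M \<subseteq> (\<lambda>x. (x, f' x)) ` K'" using K' P by (auto simp: P_def)
    ultimately have "(\<lambda>x. (x, f' x)) ` K' = M" using max unfolding A_def by blast
    then have "fst ` (\<lambda>x. (x, f' x)) ` K' = fst ` (\<lambda>x. (x, f x)) ` K" using P by (simp add: P_def)
    then show False using K'(2) by (simp add: image_image)
  qed
  then show ?thesis using P by (auto simp: P_def)
qed

end

section \<open>Separating the points of the group\<close>

context group
begin

definition center :: "'a set" where
  "center = {w \<in> carrier G. \<forall>x\<in>carrier G. w \<otimes> x = x \<otimes> w}"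

lemma center_closed: "w \<in> center \<Longrightarrow> w \<in> carrier G"
  by (simp add: center_def)

lemma center_comm: "\<lbrakk>w \<in> center; x \<in> carrier G\<rbrakk> \<Longrightarrow> w \<otimes> x = x \<otimes> w"
  unfolding center_def by blast

lemma subgroup_center: "subgroup center G"
proof (rule subgroupI)
  show "center \<subseteq> carrier G" using center_closed by blast
  have "\<one> \<in> center" by (simp add: center_def)
  then show "center \<noteq> {}" by blast
next
  fix w assume w: "w \<in> center"
  note wc = center_closed[OF w]
  have "inv w \<otimes> x = x \<otimes> inv w" if x: "x \<in> carrier G" for x
  proof -
    have "inv w \<otimes> (x \<otimes> w) \<otimes> inv w = inv w \<otimes> (w \<otimes> x) \<otimes> inv w" using center_comm[OF w x] by simp
    then show ?thesis using wc x by (simp add: m_assoc inv_mult_cancel)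
  qed
  then show "inv w \<in> center" unfolding center_def using wc by blast
next
  fix w w' assume w: "w \<in> center" "w' \<in> center"
  note wc = center_closed[OF w(1)] center_closed[OF w(2)]
  have "w \<otimes> w' \<otimes> x = x \<otimes> (w \<otimes> w')" if x: "x \<in> carrier G" for x
  proof -
    have "w \<otimes> w' \<otimes> x = w \<otimes> (x \<otimes> w')" using center_comm[OF w(2) x] wc x by (simp only: m_assoc)
    also have "\<dots> = x \<otimes> (w \<otimes> w')"
      using center_comm[OF w(1) x] wc x by (simp only: m_assoc[symmetric])
    finally show ?thesis .
  qed
  then show "w \<otimes> w' \<in> center" unfolding center_def using wc by blast
qed

end

text \<open>Along \<open>g\<close> the difference of \<open>l\<close> is the constant
  \<open>l g\<close>, which has degree less than \<open>c - w\<close> as long as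
  \<open>w < c\<close>; for \<open>w \<ge> c\<close> the element \<open>g\<close> is trivial. This
  is where the bound \<open>Suc c\<close>, that is n, comes from.\<close>

lemma (in filtered_pair) good_hom:
  fixes l :: "'a \<Rightarrow> 'q::comm_ring_1"
  assumes K: "subgroup K G" and HK: "H \<subseteq> K"
    and l: "\<And>x y. \<lbrakk>x \<in> K; y \<in> K\<rbrakk> \<Longrightarrow> l (x \<otimes> y) = l x + l y"
  shows "good K (Suc c) l"
proof -
  note Kc = subgroup.mem_carrier[OF K] and Km = subgroup.m_closed[OF K]
  have "poly K (c - w) (\<lambda>x. right_translate g l x - l x)" if g: "g \<in> K" "g \<in> F w" for w g
  proof (cases "w < c")
    case True
    then have "poly K (c - w) (\<lambda>x. l g)" by (intro poly_const[OF K]) simp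
    then show ?thesis
      by (rule poly_cong[OF K, rotated]) (simp add: right_translate_def l g(1))
  next
    case False
    then have "g = \<one>" using F_eq_one[of w g] g(2) by simp
    then show ?thesis using Kc by (intro poly_zero K) (simp add: right_translate_def)
  qed
  moreover have "affine K l"
    unfolding affine_def using HK by (auto simp: l Km subset_iff)
  ultimately show ?thesis by (simp add: good_def)
qed

text \<open>The extension theorem does the work, for the filtration with one nontrivial term and the
  trivial subgroup in the role of \<open>H\<close>: the exponent function on the powers of
  \<open>z\<close> extends to a polynomial function of degree at most 1.\<close>

lemma (in comm_group) exists_hom_nonzero:
  assumes z: "z \<in> carrier G" and inf: "\<And>k::nat. \<lbrakk>0 < k; z [^] k = \<one>\<rbrakk> \<Longrightarrow> False"
  shows "\<exists>l :: 'a \<Rightarrow> 'q::field_char_0.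
    (\<forall>x\<in>carrier G. \<forall>y\<in>carrier G. l (x \<otimes> y) = l x + l y) \<and> l z \<noteq> 0"
proof -
  define F where "F i = (if i = (0::nat) then carrier G else {\<one>})" for i
  have normal_carrier: "carrier G \<lhd> G" by (rule normal_invI[OF subgroup_self]) simp
  have comm1: "commutator x y = \<one>" if "x \<in> carrier G" "y \<in> carrier G" for x y
    using that by (simp add: commutator_def m_comm[of x y] word_simps)
  interpret filtered_pair G F 1 "{\<one>}"
    by (intro filtered_pair.intro filtered_group.intro filtered_group_axioms.intro
        filtered_pair_axioms.intro is_group)
      (auto simp only: F_def comm1 one_is_normal normal_carrier one_closed split: if_splits)
  have inj: "i = j" if "z [^] i = z [^] (j::int)" for i j
  proof (rule ccontr)
    assume "i \<noteq> j"
    have "z [^] (i - j) = \<one>" "z [^] (j - i) = \<one>" using that z by (simp_all add: int_pow_diff)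
    then have "z [^] nat \<bar>i - j\<bar> = \<one>"
      using int_pow_int[of G z "nat \<bar>i - j\<bar>"] by (auto simp: abs_if)
    then show False using inf[of "nat \<bar>i - j\<bar>"] \<open>i \<noteq> j\<close> by simp
  qed
  define K where "K = range (\<lambda>i::int. z [^] i)"
  define f\<^sub>0 :: "'a \<Rightarrow> 'q" where "f\<^sub>0 x = of_int (THE i. x = z [^] i)" for x
  have f\<^sub>0: "f\<^sub>0 (z [^] i) = of_int i" for i
  proof -
    have "(THE j. z [^] i = z [^] j) = i" by (rule the_equality) (auto dest: inj)
    then show ?thesis by (simp add: f\<^sub>0_def)
  qed
  have K: "subgroup K G"
  proof (rule subgroupI)
    show "inv x \<in> K" if "x \<in> K" for x
      using that z by (auto simp: K_def int_pow_neg[symmetric])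
    show "x \<otimes> y \<in> K" if "x \<in> K" "y \<in> K" for x y
      using that z by (auto simp: K_def int_pow_mult[symmetric])
  qed (use z in \<open>auto simp: K_def\<close>)
  have "good K (Suc 1) f\<^sub>0"
    using K by (rule good_hom)
      (use subgroup.one_closed[OF K] z in \<open>auto simp: K_def int_pow_mult[symmetric] f\<^sub>0\<close>)
  then obtain f :: "'a \<Rightarrow> 'q" where f: "good (carrier G) (Suc 1) f" "\<And>x. x \<in> K \<Longrightarrow> f x = f\<^sub>0 x"
    using extension_exists[OF K, of "Suc 1" f\<^sub>0] subgroup.one_closed[OF K] by auto
  have f1: "f \<one> = 0" using f(2)[OF subgroup.one_closed[OF K]] f\<^sub>0[of 0] by simp
  have "z [^] (1::int) \<in> K" unfolding K_def by (rule rangeI)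
  then have fz: "f z = 1" using f(2)[of z] f\<^sub>0[of 1] z by simp
  have "f (x \<otimes> y) = f x + f y" if xy: "x \<in> carrier G" "y \<in> carrier G" for x y
  proof -
    \<comment> \<open>Second differences of \<open>f\<close> vanish; together with
      \<open>f \<one> = 0\<close> this is additivity.\<close>
    have "poly (carrier G) (Suc 0) (\<lambda>v. right_translate y f v - f v)"
      using poly_diff_step[OF subgroup_self, of "Suc 1" f y 0] f(1) xy by (simp add: good_def F_def)
    from poly_diff_step[OF subgroup_self this xy(1), of 0] xy(1)
    have "\<forall>v\<in>carrier G. right_translate x (\<lambda>v. right_translate y f v - f v) v
        - (right_translate y f v - f v) = 0"
      by (simp add: F_def)
    from bspec[OF this one_closed] show ?thesis
      using xy f1 by (simp add: right_translate_def diff_eq_eq add.commute)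
  qed
  then show ?thesis using fz by (intro exI[of _ f]) auto
qed

lemma (in filtered_pair) eq_one_if_translation_trivial:
  assumes tf: "torsion_free G" and H_comm: "\<And>x y. \<lbrakk>x \<in> H; y \<in> H\<rbrakk> \<Longrightarrow> x \<otimes> y = y \<otimes> x"
    and g: "g \<in> carrier G"
    and triv: "\<And>f :: 'a \<Rightarrow> 'q::field_char_0. good (carrier G) (Suc c) f
      \<Longrightarrow> \<forall>x\<in>carrier G. f (g \<otimes> x) = f x"
  shows "g = \<one>"
proof (rule ccontr)
  assume "g \<noteq> \<one>"
  define N where "N = {g \<in> carrier G. \<forall>f :: 'a \<Rightarrow> 'q. good (carrier G) (Suc c) f
      \<longrightarrow> (\<forall>x\<in>carrier G. f (g \<otimes> x) = f x)}"
  have N_D: "f (n \<otimes> x) = f x" if "n \<in> N" "good (carrier G) (Suc c) f" "x \<in> carrier G"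
    for n x and f :: "'a \<Rightarrow> 'q"
    using that unfolding N_def by blast
  have N_comm: "commutator n x \<in> N" if n: "n \<in> N" and x: "x \<in> carrier G" for n x
  proof -
    have nc: "n \<in> carrier G" using n by (simp add: N_def)
    have "f (commutator n x \<otimes> y) = f y" if f: "good (carrier G) (Suc c) f" and y: "y \<in> carrier G"
      for f :: "'a \<Rightarrow> 'q" and y
    proof -
      \<comment> \<open>The argument of \<open>f\<close> becomes
        \<open>n \<otimes> (x \<otimes> ?w)\<close>. First \<open>n\<close> is removed in front;
        then it is inserted in front of \<open>?w\<close>, which leaves the left translate of
        \<open>f\<close> by \<open>x\<close> unchanged because that translate is good again.\<close>
      let ?w = "inv n \<otimes> (inv x \<otimes> y)"
      have w: "?w \<in> carrier G" using nc x y by simp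
      have "f (commutator n x \<otimes> y) = f (n \<otimes> (x \<otimes> ?w))"
        using nc x y by (simp add: commutator_def m_assoc)
      also have "\<dots> = f (x \<otimes> ?w)" using n f x w by (intro N_D) auto
      also have "\<dots> = left_translate x f ?w" by (simp add: left_translate_def)
      also have "\<dots> = left_translate x f (n \<otimes> ?w)"
        using N_D[OF n good_left_translate[OF subgroup_self subgroup.subset[OF H_subgroup] f x] w] ..
      also have "\<dots> = f y" using nc x y by (simp add: left_translate_def inv_mult_cancel)
      finally show ?thesis .
    qed
    then show ?thesis using nc x by (simp add: N_def)
  qed
  \<comment> \<open>A nontrivial element of \<open>N\<close> at the deepest possible level is
    central: its commutators lie in \<open>N\<close> one level deeper, so they are trivial.\<close>
  define I where "I = {i. \<exists>n\<in>N. n \<in> F i \<and> n \<noteq> \<one>}"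
  have "0 \<in> I" using g triv \<open>g \<noteq> \<one>\<close> F_0 by (auto simp: I_def N_def)
  moreover have bound: "i \<le> c" if "i \<in> I" for i
    using that F_eq_one[of i] by (auto simp: I_def intro: ccontr)
  ultimately have fin: "finite I" and ne: "I \<noteq> {}"
    using finite_subset[of I "{..c}"] by auto
  obtain z where z: "z \<in> N" "z \<in> F (Max I)" "z \<noteq> \<one>" using Max_in[OF fin ne] by (auto simp: I_def)
  have zc: "z \<in> carrier G" using z(1) by (simp add: N_def)
  have "z \<otimes> x = x \<otimes> z" if x: "x \<in> carrier G" for x
  proof -
    have "commutator z x \<in> F (Suc (Max I))" using F_commutator[OF z(2), of x 0] x F_0 by simp
    moreover have "Suc (Max I) \<notin> I" using Max_ge[OF fin, of "Suc (Max I)"] by auto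
    ultimately have "commutator z x = \<one>" using N_comm[OF z(1) x] by (auto simp: I_def)
    then have "commutator z x \<otimes> (x \<otimes> z) = x \<otimes> z" using x zc by simp
    then show ?thesis using x zc by (simp add: commutator_def word_simps)
  qed
  then have zZ: "z \<in> center" using zc by (simp add: center_def)
  define K where "K = {h \<otimes> w | h w. h \<in> H \<and> w \<in> center}"
  have prod: "(h \<otimes> w) \<otimes> (h' \<otimes> w') = (h \<otimes> h') \<otimes> (w \<otimes> w')"
    if w: "w \<in> center" and c: "h \<in> carrier G" "h' \<in> carrier G" "w' \<in> carrier G" for h w h' w'
  proof -
    have wc: "w \<in> carrier G" using w by (rule center_closed)
    have "w \<otimes> (h' \<otimes> w') = h' \<otimes> (w \<otimes> w')"
      using center_comm[OF w c(2)] c wc by (simp only: m_assoc[symmetric])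
    then show ?thesis using c wc by (simp add: m_assoc)
  qed
  have Kmem: "h \<otimes> w \<in> K" if "h \<in> H" "w \<in> center" for h w using that by (auto simp: K_def)
  have KE: "\<exists>h w. x = h \<otimes> w \<and> h \<in> H \<and> w \<in> center \<and> h \<in> carrier G \<and> w \<in> carrier G"
    if "x \<in> K" for x
    using that H_closed center_closed by (auto simp: K_def)
  have K_comm: "x \<otimes> y = y \<otimes> x" if xy: "x \<in> K" "y \<in> K" for x y
  proof -
    obtain h w where x: "x = h \<otimes> w" "h \<in> H" "w \<in> center" "h \<in> carrier G" "w \<in> carrier G"
      using KE[OF xy(1)] by blast
    obtain h' w' where y: "y = h' \<otimes> w'" "h' \<in> H" "w' \<in> center" "h' \<in> carrier G" "w' \<in> carrier G"
      using KE[OF xy(2)] by blast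
    show ?thesis
      unfolding x(1) y(1) prod[OF x(3,4) y(4,5)] prod[OF y(3,4) x(4,5)]
        center_comm[OF x(3) y(5)] H_comm[OF x(2) y(2)] ..
  qed
  have K: "subgroup K G"
  proof (rule subgroupI)
    show "K \<subseteq> carrier G" using KE by blast
    show "K \<noteq> {}" using zZ Kmem subgroup.one_closed[OF H_subgroup] by blast
  next
    fix x assume "x \<in> K"
    then obtain h w where x: "x = h \<otimes> w" "h \<in> H" "w \<in> center" "h \<in> carrier G" "w \<in> carrier G"
      using KE by blast
    have wi: "inv w \<in> center" using subgroup.m_inv_closed[OF subgroup_center x(3)] .
    have "inv x = inv h \<otimes> inv w"
      using center_comm[OF wi, of "inv h"] x(4,5) by (simp add: x(1) inv_mult_group)
    then show "inv x \<in> K" using Kmem[OF subgroup.m_inv_closed[OF H_subgroup x(2)] wi] by simp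
  next
    fix x y assume xy: "x \<in> K" "y \<in> K"
    obtain h w where x: "x = h \<otimes> w" "h \<in> H" "w \<in> center" "h \<in> carrier G" "w \<in> carrier G"
      using KE[OF xy(1)] by blast
    obtain h' w' where y: "y = h' \<otimes> w'" "h' \<in> H" "w' \<in> center" "h' \<in> carrier G" "w' \<in> carrier G"
      using KE[OF xy(2)] by blast
    show "x \<otimes> y \<in> K"
      unfolding x(1) y(1) prod[OF x(3,4) y(4,5)]
      using Kmem[OF subgroup.m_closed[OF H_subgroup x(2) y(2)]
          subgroup.m_closed[OF subgroup_center x(3) y(3)]] .
  qed
  have HK: "H \<subseteq> K"
    using Kmem[OF _ subgroup.one_closed[OF subgroup_center]] H_closed by fastforce
  have zK: "z \<in> K" using Kmem[OF subgroup.one_closed[OF H_subgroup] zZ] zc by simp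
  interpret A: comm_group "G\<lparr>carrier := K\<rparr>"
    by (rule group.group_comm_groupI[OF subgroup.subgroup_is_group[OF K group_axioms]])
      (simp add: K_comm)
  have no_torsion: "False" if "0 < k" "z [^]\<^bsub>G\<lparr>carrier := K\<rparr>\<^esub> k = \<one>\<^bsub>G\<lparr>carrier := K\<rparr>\<^esub>" for k :: nat
    using that tf zc z(3) by (simp add: torsion_free_def nat_pow_consistent[symmetric])
  have "\<exists>l :: 'a \<Rightarrow> 'q. (\<forall>x\<in>K. \<forall>y\<in>K. l (x \<otimes> y) = l x + l y) \<and> l z \<noteq> 0"
    using A.exists_hom_nonzero[OF _ no_torsion] zK by simp
  then obtain l :: "'a \<Rightarrow> 'q" where l: "\<And>x y. \<lbrakk>x \<in> K; y \<in> K\<rbrakk> \<Longrightarrow> l (x \<otimes> y) = l x + l y" "l z \<noteq> 0"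
    by blast
  obtain f :: "'a \<Rightarrow> 'q" where f: "good (carrier G) (Suc c) f" "\<forall>x\<in>K. f x = l x"
    using extension_exists[OF K HK good_hom[OF K HK l(1)]] by blast
  have "f (z \<otimes> \<one>) = f \<one>" using N_D[OF z(1) f(1) one_closed] .
  moreover have "l \<one> = 0" using l(1)[of \<one> \<one>] subgroup.one_closed[OF K] by simp
  ultimately show False using f(2) zK zc subgroup.one_closed[OF K] l(2) by simp
qed

section \<open>The module of good functions\<close>

context group
begin

text \<open>Left translations compose to a right action: \<open>y\<close> followed by
  \<open>z\<close> gives \<open>y \<otimes> z\<close>. The value 0 off the group lets the module
  laws hold as equations between functions.\<close>

definition translate :: "'a \<Rightarrow> ('a \<Rightarrow> 'q) \<Rightarrow> 'a \<Rightarrow> 'q::comm_ring_1" where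
  "translate y f = (\<lambda>x. if x \<in> carrier G then f (y \<otimes> x) else 0)"

definition act :: "('a \<Rightarrow> 'q) \<Rightarrow> ('a \<Rightarrow> 'q) \<Rightarrow> 'a \<Rightarrow> 'q::comm_ring_1" where
  "act f a = (\<lambda>x. \<Sum>y\<in>supp a. a y * translate y f x)"

lemma act_eq:
  assumes "finite S" "supp a \<subseteq> S"
  shows "act f a x = (\<Sum>y\<in>S. a y * translate y f x)"
  unfolding act_def using assms by (intro sum.mono_neutral_left) (auto simp: supp_def)

lemma act_add_right:
  assumes "a \<in> carrier (group_ring G)" "b \<in> carrier (group_ring G)"
  shows "act f (a \<oplus>\<^bsub>group_ring G\<^esub> b) x = act f a x + act f b x"
proof -
  let ?S = "supp a \<union> supp b"
  have S: "finite ?S" using assms by (simp add: group_ring_carrier_iff)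
  have "supp (a \<oplus>\<^bsub>group_ring G\<^esub> b) \<subseteq> ?S" by (auto simp: supp_def group_ring_def)
  then show ?thesis
    by (simp add: act_eq[OF S Un_upper1] act_eq[OF S Un_upper2] act_eq[OF S]
        group_ring_def distrib_right sum.distrib)
qed

lemma act_add_left: "act (\<lambda>x. f x + g x) a x = act f a x + act g a x"
  by (cases "x \<in> carrier G") (simp_all add: act_def translate_def distrib_left sum.distrib)

lemma act_group_elt: "act f (group_elt g) x = translate g f x"
  by (simp add: act_def supp_group_elt group_elt_apply)

lemma act_mult:
  assumes a: "a \<in> carrier (group_ring G)" and b: "b \<in> carrier (group_ring G)"
  shows "act f (a \<otimes>\<^bsub>group_ring G\<^esub> b) x = act (act f a) b x"
proof (cases "x \<in> carrier G")
  case False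
  then show ?thesis by (simp add: act_def translate_def)
next
  case True
  let ?P = "(\<lambda>(v, w). v \<otimes> w) ` (supp a \<times> supp b)"
  have fin: "finite (supp a)" "finite (supp b)" and sub: "supp a \<subseteq> carrier G" "supp b \<subseteq> carrier G"
    using a b by (auto simp: group_ring_carrier_iff)
  have P: "finite ?P" using fin by simp
  have "act f (a \<otimes>\<^bsub>group_ring G\<^esub> b) x
      = (\<Sum>g\<in>?P. (\<Sum>v\<in>supp a. \<Sum>w\<in>supp b. if v \<otimes> w = g then a v * b w else 0) * f (g \<otimes> x))"
    unfolding act_eq[OF P group_ring_mult_supp]
    by (simp add: group_ring_mult_apply[OF fin order_refl order_refl] translate_def True)
  also have "\<dots> = (\<Sum>g\<in>?P. \<Sum>v\<in>supp a. \<Sum>w\<in>supp b.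
      if v \<otimes> w = g then a v * b w * f (v \<otimes> w \<otimes> x) else 0)"
    by (auto simp: sum_distrib_right intro!: sum.cong)
  also have "\<dots> = (\<Sum>v\<in>supp a. \<Sum>w\<in>supp b. \<Sum>g\<in>?P.
      if v \<otimes> w = g then a v * b w * f (v \<otimes> w \<otimes> x) else 0)"
    by (rule trans[OF sum.swap], rule sum.cong[OF refl], rule sum.swap)
  also have "\<dots> = (\<Sum>v\<in>supp a. \<Sum>w\<in>supp b. a v * b w * f (v \<otimes> w \<otimes> x))"
    using P by (intro sum.cong refl) (subst sum.delta', auto)
  also have "\<dots> = (\<Sum>v\<in>supp a. \<Sum>w\<in>supp b. b w * (a v * f (v \<otimes> (w \<otimes> x))))"
    using sub True by (intro sum.cong refl) (simp add: m_assoc subset_iff mult_ac)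
  also have "\<dots> = (\<Sum>w\<in>supp b. \<Sum>v\<in>supp a. b w * (a v * f (v \<otimes> (w \<otimes> x))))"
    by (rule sum.swap)
  also have "\<dots> = act (act f a) b x"
    using sub True by (auto simp: act_def translate_def sum_distrib_left intro!: sum.cong)
  finally show ?thesis .
qed

text \<open>On an element of the augmentation ideal the coefficients sum to 0, so it acts as a
  combination of the differences in \<open>lower\<close>; each further factor therefore costs one
  level. \<open>D\<close> is abstract because \<open>G\<close> and \<open>H\<close> need different
  gradings.\<close>

lemma act_ideal_power:
  fixes D :: "nat \<Rightarrow> ('a \<Rightarrow> 'q::comm_ring_1) \<Rightarrow> bool"
  assumes L: "subgroup L G"
    and zero: "\<And>d. D d (\<lambda>x. 0)"
    and add: "\<And>d f g. \<lbrakk>D d f; D d g\<rbrakk> \<Longrightarrow> D d (\<lambda>x. f x + g x)"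
    and scale: "\<And>d f q. D d f \<Longrightarrow> D d (\<lambda>x. q * f x)"
    and trans: "\<And>d f y. \<lbrakk>y \<in> L; D d f\<rbrakk> \<Longrightarrow> D d (translate y f)"
    and lower: "\<And>d f y. \<lbrakk>y \<in> L; D d f\<rbrakk> \<Longrightarrow> D (d - 1) (\<lambda>x. translate y f x - f x)"
    and a: "a \<in> ideal_power (group_ring (G\<lparr>carrier := L\<rparr>)) (augmentation_ideal (G\<lparr>carrier := L\<rparr>)) r"
    and f: "D d f"
  shows "D (d - r) (act f a)"
proof -
  let ?R = "group_ring (G\<lparr>carrier := L\<rparr>) :: ('a \<Rightarrow> 'q) ring" and ?I = "augmentation_ideal (G\<lparr>carrier := L\<rparr>)"
  have gL: "group (G\<lparr>carrier := L\<rparr>)" using L by (simp add: subgroup.subgroup_is_group)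
  have RG: "b \<in> carrier (group_ring G)" if "b \<in> carrier ?R" for b
    using that subgroup.subset[OF L] by (auto simp: group_ring_carrier_iff)
  have ops: "b \<otimes>\<^bsub>?R\<^esub> b' = b \<otimes>\<^bsub>group_ring G\<^esub> b'" "b \<oplus>\<^bsub>?R\<^esub> b' = b \<oplus>\<^bsub>group_ring G\<^esub> b'" for b b'
    by (simp_all add: group_ring_def)
  have sum: "D d (\<lambda>x. \<Sum>i\<in>I. g i x)" if "\<And>i. i \<in> I \<Longrightarrow> D d (g i)" for d and I :: "'a set" and g
    using that by (induction I rule: infinite_finite_induct) (auto simp: zero add)
  have carrier_act: "D d (act f b)" if "b \<in> carrier ?R" "D d f" for b d f
    unfolding act_def using that by (intro sum scale trans) (auto simp: group_ring_carrier_iff)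
  have aug_act: "D (d - 1) (act f b)" if b: "b \<in> ?I" and f: "D d f" for b d f
  proof -
    have bL: "supp b \<subseteq> L" and b0: "(\<Sum>y\<in>supp b. b y) = 0"
      using b by (auto simp: augmentation_ideal_def group_ring_carrier_iff augmentation_def)
    have "act f b = (\<lambda>x. \<Sum>y\<in>supp b. b y * (translate y f x - f x))"
      using b0 by (simp add: act_def right_diff_distrib sum_subtractf sum_distrib_right[symmetric])
    moreover have "D (d - 1) (\<lambda>x. \<Sum>y\<in>supp b. b y * (translate y f x - f x))"
      using bL f by (intro sum scale lower) auto
    ultimately show ?thesis by simp
  qed
  have "a \<in> carrier ?R \<and> (\<forall>d f. D d f \<longrightarrow> D (d - r) (act f a))"
    using a
  proof (induction r arbitrary: a)
    case 0
    then show ?case using carrier_act by simp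
  next
    case (Suc r)
    have "a \<in> ideal_prod ?R (ideal_power ?R ?I r) ?I" using Suc.prems by simp
    then show ?case
    proof induction
      case (prod b b')
      have b: "b \<in> carrier ?R" "\<And>d f. D d f \<Longrightarrow> D (d - r) (act f b)" using Suc.IH[OF prod(1)] by auto
      have b': "b' \<in> carrier ?R" using prod(2) by (simp add: augmentation_ideal_def)
      have eq: "act f (b \<otimes>\<^bsub>?R\<^esub> b') = act (act f b) b'" for f
        unfolding ops using act_mult[OF RG[OF b(1)] RG[OF b']] by (rule ext)
      have "D (d - Suc r) (act f (b \<otimes>\<^bsub>?R\<^esub> b'))" if "D d f" for d f
        unfolding eq using aug_act[OF prod(2) b(2)[OF that]] by simp
      then show ?case using group_ring_mult_closed[OF gL b(1) b'] by blast
    next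
      case (sum b b')
      then have b: "b \<in> carrier ?R" "b' \<in> carrier ?R" by auto
      have eq: "act f (b \<oplus>\<^bsub>?R\<^esub> b') = (\<lambda>x. act f b x + act f b' x)" for f
        unfolding ops using act_add_right[OF RG[OF b(1)] RG[OF b(2)]] by (rule ext)
      have "D (d - Suc r) (act f (b \<oplus>\<^bsub>?R\<^esub> b'))" if "D d f" for d f
        unfolding eq using sum.IH that by (intro add) auto
      then show ?case using group_ring_add_closed[OF b] by blast
    qed
  qed
  then show ?thesis using f by blast
qed

text \<open>The target type of the theorem consists of sets of functions, so a function \<open>f\<close> is
  represented by \<open>{f}\<close>.\<close>

definition function_module :: "('a \<Rightarrow> 'q) set \<Rightarrow> ('a \<Rightarrow> 'q::comm_ring_1, ('a \<Rightarrow> 'q) set) right_module" where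
  "function_module V = \<lparr>
     carrier = (\<lambda>f. {f}) ` V, monoid.mult = (\<lambda>X Y. X), one = {}, zero = {\<lambda>x. 0},
     add = (\<lambda>X Y. {\<lambda>x. the_elem X x + the_elem Y x}),
     ract = (\<lambda>X a. {act (the_elem X) a}) \<rparr>"

lemma function_module_right_module:
  fixes V :: "('a \<Rightarrow> 'q::comm_ring_1) set"
  assumes zero: "(\<lambda>x. 0) \<in> V"
    and add: "\<And>f g. \<lbrakk>f \<in> V; g \<in> V\<rbrakk> \<Longrightarrow> (\<lambda>x. f x + g x) \<in> V"
    and scale: "\<And>f q. f \<in> V \<Longrightarrow> (\<lambda>x. q * f x) \<in> V"
    and trans: "\<And>f y. \<lbrakk>y \<in> carrier G; f \<in> V\<rbrakk> \<Longrightarrow> translate y f \<in> V"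
    and vanish: "\<And>f x. \<lbrakk>f \<in> V; x \<notin> carrier G\<rbrakk> \<Longrightarrow> f x = 0"
  shows "right_module (group_ring G) (function_module V)"
proof -
  let ?M = "function_module V"
  have sum: "(\<lambda>x. \<Sum>i\<in>I. g i x) \<in> V" if "\<And>i. i \<in> I \<Longrightarrow> g i \<in> V" for I :: "'a set" and g
    using that by (induction I rule: infinite_finite_induct) (auto simp: zero add)
  have act_closed: "act f a \<in> V" if "f \<in> V" "a \<in> carrier (group_ring G)" for f a
    unfolding act_def using that by (intro sum scale trans) (auto simp: group_ring_carrier_iff)
  have "abelian_group ?M"
  proof (rule abelian_groupI)
    fix X assume "X \<in> carrier ?M"
    then obtain f where f: "f \<in> V" "X = {f}" by (auto simp: function_module_def)
    have "(\<lambda>x. - f x) \<in> V" using scale[OF f(1), of "-1"] by simp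
    then show "\<exists>Y\<in>carrier ?M. Y \<oplus>\<^bsub>?M\<^esub> X = \<zero>\<^bsub>?M\<^esub>"
      by (intro bexI[of _ "{\<lambda>x. - f x}"]) (auto simp: function_module_def f(2))
  qed (auto simp: function_module_def zero add algebra_simps)
  moreover have "ring (group_ring G :: ('a \<Rightarrow> 'q) ring)" using is_group by (rule group_ring_ring)
  moreover have "act f \<one>\<^bsub>group_ring G\<^esub> = f" if "f \<in> V" for f
  proof
    have one: "\<one>\<^bsub>group_ring G\<^esub> = (group_elt \<one> :: 'a \<Rightarrow> 'q)" by (simp add: group_ring_def)
    show "act f \<one>\<^bsub>group_ring G\<^esub> x = f x" for x
      unfolding one using vanish[OF that] by (simp add: act_group_elt translate_def)
  qed
  ultimately show ?thesis
    by (intro right_module.intro right_module_axioms.intro)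
      (auto simp: function_module_def act_closed act_add_left act_add_right act_mult fun_eq_iff)
qed

lemma function_module_stable:
  fixes V :: "('a \<Rightarrow> 'q::comm_ring_1) set"
  assumes "abelian_group (function_module V)"
    and "\<And>f a. \<lbrakk>f \<in> V; a \<in> ideal_power (group_ring L) (augmentation_ideal L) r\<rbrakk> \<Longrightarrow> act f a = (\<lambda>x. 0)"
  shows "step_stable r L (function_module V)"
proof -
  let ?M = "function_module V" and ?I = "ideal_power (group_ring L) (augmentation_ideal L) r"
  interpret M: abelian_group ?M by fact
  have "{X \<triangleleft>\<^bsub>?M\<^esub> a | X a. X \<in> carrier ?M \<and> a \<in> ?I} \<subseteq> {\<zero>\<^bsub>?M\<^esub>}"
    using assms(2) by (auto simp: function_module_def)
  then have "module_times ?M ?I \<subseteq> {\<zero>\<^bsub>?M\<^esub>}"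
    unfolding module_times_def
    using M.add.generate_subgroup_incl[OF _ M.add.triv_subgroup] by simp
  moreover have "\<zero>\<^bsub>?M\<^esub> \<in> module_times ?M ?I"
    unfolding module_times_def using generate.one[of "add_monoid ?M"] by simp
  ultimately show ?thesis unfolding step_stable_def by blast
qed

end

section \<open>The module of good functions of degree less than \<open>n\<close>: faithfulness and
  the two stability conditions\<close>

theorem mainTheorem7:
  fixes G :: "('g, 'b) monoid_scheme" and H :: "'g set" and n :: nat
  assumes "2 \<le> n"
    and "group G"
    and "torsion_free G"
    and "nilpotent G" and "nilpotency_class G = n - 1"
    and "H \<lhd> G"
    and "comm_group (G\<lparr>carrier := H\<rparr>)"
  shows "\<exists>M :: ('g \<Rightarrow> rat, ('g \<Rightarrow> rat) set) right_module.
           right_module (group_ring G) M \<and>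
           faithful_rep G M \<and>
           step_stable n G M \<and>
           step_stable 2 (G\<lparr>carrier := H\<rparr>) M"
proof -
  interpret group G by fact
  define c where "c = n - 1"
  have n: "n = Suc c" using assms(1) by (simp add: c_def)
  have "lower_central G c = {\<one>\<^bsub>G\<^esub>}"
    using assms(4,5) LeastI_ex[of "\<lambda>c. lower_central G c = {\<one>\<^bsub>G\<^esub>}"]
    unfolding nilpotent_def nilpotency_class_def c_def by simp
  then interpret filtered_pair G "lower_central G" c H
    by (intro filtered_pair.intro filtered_group.intro filtered_group_axioms.intro
        filtered_pair_axioms.intro is_group lower_central_normal lower_central_Suc_subset
        lower_central_commutator assms(6)) simp_all
  have H_comm: "x \<otimes>\<^bsub>G\<^esub> y = y \<otimes>\<^bsub>G\<^esub> x" if "x \<in> H" "y \<in> H" for x y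
    using comm_monoid.m_comm[OF comm_group.axioms(1)[OF assms(7)], of x y] that by simp
  note G = subgroup_self and HG = subgroup.subset[OF H_subgroup]
  \<comment> \<open>Vanishing off the group makes each function determined by its values on it, so
    that degree 0 leaves just the zero function.\<close>
  define E where "E d f \<longleftrightarrow> good (carrier G) d f \<and> (\<forall>x. x \<notin> carrier G \<longrightarrow> f x = 0)"
    for d and f :: "'g \<Rightarrow> rat"
  define V where "V = Collect (E n)"
  have E_zero: "E d (\<lambda>x. 0)" for d by (simp add: E_def good_zero[OF G])
  have E_add: "E d (\<lambda>x. f x + g x)" if "E d f" "E d g" for d f g
    using that by (simp add: E_def good_add[OF G])
  have E_scale: "E d (\<lambda>x. q * f x)" if "E d f" for d f q
    using that by (simp add: E_def good_scale[OF G])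
  have E_translate: "E d (translate y f)" if y: "y \<in> carrier G" and f: "E d f" for d f y
  proof -
    have "good (carrier G) d (left_translate y f)"
      using f y by (intro good_left_translate[OF G HG]) (simp_all add: E_def)
    then have "good (carrier G) d (translate y f)"
      by (rule good_cong[OF G HG, rotated]) (simp add: left_translate_def translate_def)
    then show ?thesis by (simp add: E_def translate_def)
  qed
  have E_lower: "E (d - 1) (\<lambda>x. translate y f x - f x)" if y: "y \<in> carrier G" and f: "E d f" for d f y
  proof -
    have "good (carrier G) (d - Suc 0) (\<lambda>x. left_translate y f x - f x)"
      using f y by (intro good_left_translate_diff[OF G HG]) (simp_all add: E_def)
    then have "good (carrier G) (d - Suc 0) (\<lambda>x. translate y f x - f x)"
      by (rule good_cong[OF G HG, rotated]) (simp add: left_translate_def translate_def)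
    then show ?thesis using f by (simp add: E_def translate_def)
  qed
  let ?M = "function_module V"
  have M: "right_module (group_ring G) ?M"
    using E_zero E_add E_scale E_translate
    by (intro function_module_right_module) (auto simp: V_def E_def)
  then have Mab: "abelian_group ?M" by (rule right_module.axioms(2))
  have "faithful_rep G ?M"
    unfolding faithful_rep_def
  proof (intro ballI impI)
    fix g assume g: "g \<in> carrier G"
      and fixed: "\<forall>X\<in>carrier ?M. X \<triangleleft>\<^bsub>?M\<^esub> group_elt g = X"
    show "g = \<one>\<^bsub>G\<^esub>"
    proof (rule eq_one_if_translation_trivial[OF assms(3) H_comm g, where 'q = rat])
      fix f :: "'g \<Rightarrow> rat" assume f: "good (carrier G) (Suc c) f"
      define f' where "f' x = (if x \<in> carrier G then f x else 0)" for x
      have "good (carrier G) (Suc c) f'"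
        using f by (rule good_cong[OF G HG, rotated]) (simp add: f'_def)
      then have "f' \<in> V" by (simp add: V_def E_def n f'_def)
      then have "act f' (group_elt g) = f'" using fixed by (auto simp: function_module_def)
      then have eq: "translate g f' x = f' x" for x by (simp only: act_group_elt[symmetric])
      show "\<forall>x\<in>carrier G. f (g \<otimes>\<^bsub>G\<^esub> x) = f x"
      proof
        fix x assume "x \<in> carrier G"
        then show "f (g \<otimes>\<^bsub>G\<^esub> x) = f x"
          using eq[of x] g by (simp add: translate_def f'_def)
      qed
    qed
  qed
  moreover have "step_stable n G ?M"
  proof (rule function_module_stable[OF Mab])
    fix f a :: "'g \<Rightarrow> rat"
    assume f: "f \<in> V" and a: "a \<in> ideal_power (group_ring G) (augmentation_ideal G) n"

    have "E (n - n) (act f a)"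
      by (rule act_ideal_power[OF G, where D = E])
        (use a f E_zero E_add E_scale E_translate E_lower in \<open>auto simp: V_def\<close>)
    then show "act f a = (\<lambda>x. 0)" using good_0_iff[OF G HG] by (auto simp: E_def fun_eq_iff)
  qed
  moreover have "step_stable 2 (G\<lparr>carrier := H\<rparr>) ?M"
  proof (rule function_module_stable[OF Mab])
    fix f a :: "'g \<Rightarrow> rat"
    assume f: "f \<in> V"
      and a: "a \<in> ideal_power (group_ring (G\<lparr>carrier := H\<rparr>)) (augmentation_ideal (G\<lparr>carrier := H\<rparr>)) 2"
    define Hfix where "Hfix f \<longleftrightarrow> (\<forall>h\<in>H. \<forall>x\<in>carrier G. f (h \<otimes>\<^bsub>G\<^esub> x) = f x)" for f :: "'g \<Rightarrow> rat"
    \<comment> \<open>Three levels suffice for \<open>H\<close>: the whole module, the functions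
      fixed by \<open>H\<close>, and zero. Affineness says that a difference along \<open>H\<close>
      leads from level 2 to level 1.\<close>
    define D where "D d f \<longleftrightarrow> E n f \<and> (d \<le> 1 \<longrightarrow> Hfix f) \<and> (d = 0 \<longrightarrow> (\<forall>x. f x = 0))"
      for d :: nat and f :: "'g \<Rightarrow> rat"
    have D_translate: "D d (translate y f)" and D_lower: "D (d - 1) (\<lambda>x. translate y f x - f x)"
      if y: "y \<in> H" and f: "D d f" for d f y
    proof -
      note yc = H_closed[OF y]
      have En: "E n f" using f by (simp add: D_def)
      have Et: "E n (translate y f)" using E_translate[OF yc En] .
      have Ed: "E n (\<lambda>x. translate y f x - f x)" using E_add[OF Et E_scale[OF En, of "-1"]] by simp
      have eq: "translate y f = f" if "Hfix f"
        using that y En by (auto simp: Hfix_def translate_def E_def fun_eq_iff)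
      have "Hfix (\<lambda>x. translate y f x - f x)"
        unfolding Hfix_def
      proof (intro ballI)
        fix h x assume h: "h \<in> H" and x: "x \<in> carrier G"
        then have "f (y \<otimes>\<^bsub>G\<^esub> (h \<otimes>\<^bsub>G\<^esub> x)) = f (y \<otimes>\<^bsub>G\<^esub> x) + f (h \<otimes>\<^bsub>G\<^esub> x) - f x"
          using En y by (simp add: E_def good_def affine_def)
        then show "translate y f (h \<otimes>\<^bsub>G\<^esub> x) - f (h \<otimes>\<^bsub>G\<^esub> x) = translate y f x - f x"
          using h x H_closed by (simp add: translate_def)
      qed
      then show "D (d - 1) (\<lambda>x. translate y f x - f x)" using Ed f eq by (auto simp: D_def)
      show "D d (translate y f)" using Et f eq by (auto simp: D_def)
    qed
    have D_zero: "D d (\<lambda>x. 0)" for d using E_zero by (simp add: D_def Hfix_def)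
    have D_add: "D d (\<lambda>x. f x + g x)" if "D d f" "D d g" for d f g
      using that E_add by (simp add: D_def Hfix_def)
    have D_scale: "D d (\<lambda>x. q * f x)" if "D d f" for d f q
      using that E_scale by (simp add: D_def Hfix_def)
    have "D 2 f" using f by (simp add: V_def D_def)
    with H_subgroup D_zero D_add D_scale D_translate D_lower a have "D (2 - 2) (act f a)"
      by (rule act_ideal_power[where D = D])
    then show "act f a = (\<lambda>x. 0)" by (auto simp: D_def)
  qed
  ultimately show ?thesis using M by blast
qed

end
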